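(* Let $(Q,\mathfrak m_Q,\mathsf k)$ be a Gorenstein Artin local ring and let $Q=\widetilde Q/I_Q$ be its Cohen presentation, with $\mathfrak m_{\widetilde Q}=\langle Y_1,\ldots,Y_m,Z_1,\ldots,Z_n\rangle$, $m,n\geq 1$. Write $\langle\mathbf Y\rangle=\langle Y_1,\ldots,Y_m\rangle$ and $\langle\mathbf Z\rangle=\langle Z_1,\ldots,Z_n\rangle$ for the corresponding ideals of $\widetilde Q$. Let $R=\widetilde Q/J_R$ and $S=\widetilde Q/J_S$, where $J_R=(I_Q\cap\langle\mathbf Y\rangle)+\langle\mathbf Z\rangle$ and $J_S=(I_Q\cap\langle\mathbf Z\rangle)+\langle\mathbf Y\rangle$. Suppose $Y_iZ_j\in I_Q$ for all $i,j$. Then (a) $I_Q\cap\langle\mathbf Y\rangle=J_R\cap\langle\mathbf Y\rangle$ and $I_Q\cap\langle\mathbf Z\rangle=J_S\cap\langle\mathbf Z\rangle$; (b) $R$ and $S$ are Gorenstein Artin; and (c) $Q\simeq R\#_{\mathsf k}S$.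
   Context: A Cohen presentation of a local ring $T$ is a quotient $\widetilde T/I_T\simeq T$ with $(\widetilde T,\mathfrak m_{\widetilde T},\mathsf k)$ a complete regular local ring and $I_T\subset\mathfrak m_{\widetilde T}^2$ an ideal. Fibre product: for local rings $(R,\mathfrak m_R,\mathsf k)$, $(S,\mathfrak m_S,\mathsf k)$ with natural projections $\pi_R,\pi_S$ onto $\mathsf k$, $R\times_{\mathsf k}S=\{(r,s)\in R\times S:\pi_R(r)=\pi_S(s)\}$. Connected sum: if $R,S$ are Gorenstein Artin local rings with residue field $\mathsf k$, different from $\mathsf k$, and $\operatorname{soc}(R)=\langle\delta_R\rangle$, $\operatorname{soc}(S)=\langle\delta_S\rangle$ (where $\operatorname{soc}(T)$ is the annihilator of the maximal ideal of $T$), then a connected sum of $R$ and $S$ over $\mathsf k$ is $R\#_{\mathsf k}S=(R\times_{\mathsf k}S)/\langle(\delta_R,0)-(0,\delta_S)\rangle$. It depends on the chosen socle generators; $Q\simeq R\#_{\mathsf k}S$ means that this holds for some choice.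
   Formalization: The generators Y_1,…,Y_m,Z_1,…,Z_n are assumed to be a minimal generating set of the maximal ideal of Q̃ (m+n is its embedding dimension); otherwise (a) fails, e.g. for Q̃=k[[x]], I_Q=(x²), Y_1=Z_1=x. *)

theory Defs
  imports "HOL-Algebra.Algebra" "HOL-Library.Extended_Nat"
begin

section \<open>Local rings\<close>

text \<open>Local rings are commutative and Noetherian.\<close>

locale local_ring = cring R + noetherian_ring R for R (structure) +
  assumes unique_maximalideal: "\<exists>!M. maximalideal M R"

definition max_ideal :: "('a, 'b) ring_scheme \<Rightarrow> 'a set" where
  "max_ideal R = (THE M. maximalideal M R)"

definition artinian_ring :: "('a, 'b) ring_scheme \<Rightarrow> bool" where
  "artinian_ring R \<longleftrightarrow> ring R \<and>
     (\<forall>I :: nat \<Rightarrow> 'a set. (\<forall>n. ideal (I n) R \<and> I (Suc n) \<subseteq> I n)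
        \<longrightarrow> (\<exists>N. \<forall>n\<ge>N. I n = I N))"

definition soc :: "('a, 'b) ring_scheme \<Rightarrow> 'a set" where
  "soc R = {x \<in> carrier R. \<forall>a \<in> max_ideal R. a \<otimes>\<^bsub>R\<^esub> x = \<zero>\<^bsub>R\<^esub>}"

text \<open>An Artinian local ring is Gorenstein if its socle is a one-dimensional vector space over
  the residue field. As the maximal ideal annihilates the socle, its subspaces are the ideals
  contained in it, and dimension one means: generated by a single nonzero element.\<close>

definition gorenstein_artin_local :: "('a, 'b) ring_scheme \<Rightarrow> bool" where
  "gorenstein_artin_local R \<longleftrightarrow> local_ring R \<and> artinian_ring R \<and>
     (\<exists>\<delta> \<in> carrier R. \<delta> \<noteq> \<zero>\<^bsub>R\<^esub> \<and> soc R = PIdl\<^bsub>R\<^esub> \<delta>)"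


section \<open>Complete regular local rings and Cohen presentations\<close>

primrec ideal_pow :: "('a, 'b) ring_scheme \<Rightarrow> 'a set \<Rightarrow> nat \<Rightarrow> 'a set" where
  "ideal_pow R I 0 = carrier R"
| "ideal_pow R I (Suc n) = ideal_pow R I n \<cdot>\<^bsub>R\<^esub> I"

text \<open>The canonical map from \<open>R\<close> to the inverse limit of the rings \<open>R / m\<^sup>n\<close> is bijective:
  every family of representatives that is compatible modulo the powers of \<open>m\<close> comes from
  exactly one element of \<open>R\<close>. In particular \<open>R\<close> is separated.\<close>

definition complete_local_ring :: "('a, 'b) ring_scheme \<Rightarrow> bool" where
  "complete_local_ring R \<longleftrightarrow> local_ring R \<and>
     (\<forall>x :: nat \<Rightarrow> 'a.
        (\<forall>n. x n \<in> carrier R \<and> x (Suc n) \<ominus>\<^bsub>R\<^esub> x n \<in> ideal_pow R (max_ideal R) n)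
        \<longrightarrow> (\<exists>!l. l \<in> carrier R \<and> (\<forall>n. l \<ominus>\<^bsub>R\<^esub> x n \<in> ideal_pow R (max_ideal R) n)))"

definition krull_dim :: "('a, 'b) ring_scheme \<Rightarrow> enat" where
  "krull_dim R = (SUP n \<in> {n. \<exists>P :: nat \<Rightarrow> 'a set.
     (\<forall>i\<le>n. primeideal (P i) R) \<and> (\<forall>i<n. P i \<subset> P (Suc i))}. enat n)"

text \<open>The embedding dimension, i.e. the minimal number of generators of the maximal ideal.\<close>

definition edim :: "('a, 'b) ring_scheme \<Rightarrow> nat" where
  "edim R = (LEAST d. \<exists>A \<subseteq> carrier R. finite A \<and> card A = d \<and> max_ideal R = Idl\<^bsub>R\<^esub> A)"

definition regular_local_ring :: "('a, 'b) ring_scheme \<Rightarrow> bool" where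
  "regular_local_ring R \<longleftrightarrow> local_ring R \<and> krull_dim R = enat (edim R)"

definition cohen_presentation ::
    "('t, 'x) ring_scheme \<Rightarrow> ('a, 'y) ring_scheme \<Rightarrow> 'a set \<Rightarrow> bool" where
  "cohen_presentation T T' I \<longleftrightarrow>
     local_ring T \<and> complete_local_ring T' \<and> regular_local_ring T' \<and>
     ideal I T' \<and> I \<subseteq> ideal_pow T' (max_ideal T') 2 \<and> T' Quot I \<simeq> T"


section \<open>Fibre products and connected sums\<close>

text \<open>The identification of the residue fields of \<open>R\<close> and \<open>S\<close> with one field \<open>k\<close> is given by the
  projections \<open>pR\<close> and \<open>pS\<close> onto \<open>k\<close>.\<close>

definition fibre_product ::
    "('a, 'x) ring_scheme \<Rightarrow> ('a \<Rightarrow> 'k) \<Rightarrow> ('b, 'y) ring_scheme \<Rightarrow> ('b \<Rightarrow> 'k) \<Rightarrow> ('a \<times> 'b) ring" where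
  "fibre_product R pR S pS =
     (RDirProd R S) \<lparr>carrier := {(r, s). r \<in> carrier R \<and> s \<in> carrier S \<and> pR r = pS s}\<rparr>"

definition connected_sum ::
    "('a, 'x) ring_scheme \<Rightarrow> ('a \<Rightarrow> 'k) \<Rightarrow> 'a \<Rightarrow> ('b, 'y) ring_scheme \<Rightarrow> ('b \<Rightarrow> 'k) \<Rightarrow> 'b
      \<Rightarrow> ('a \<times> 'b) set ring" where
  "connected_sum R pR \<delta>R S pS \<delta>S =
     (let P = fibre_product R pR S pS
      in P Quot (PIdl\<^bsub>P\<^esub> ((\<delta>R, \<zero>\<^bsub>S\<^esub>) \<ominus>\<^bsub>P\<^esub> (\<zero>\<^bsub>R\<^esub>, \<delta>S))))"

text \<open>Being isomorphic to a connected sum, for some choice of socle generators. The conditions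
  under which connected sums are formed are included: the ring is Gorenstein Artin local, has
  residue field \<open>k\<close> via a surjective homomorphism (whose kernel is then automatically the maximal
  ideal), and is different from \<open>k\<close>, i.e. its maximal ideal is nonzero.\<close>

definition connected_summand ::
    "('k, 'z) ring_scheme \<Rightarrow> ('a, 'x) ring_scheme \<Rightarrow> ('a \<Rightarrow> 'k) \<Rightarrow> bool" where
  "connected_summand k R pR \<longleftrightarrow>
     gorenstein_artin_local R \<and> field k \<and> pR \<in> ring_hom R k \<and> pR ` carrier R = carrier k \<and>
     max_ideal R \<noteq> {\<zero>\<^bsub>R\<^esub>}"

definition is_connected_sum ::
    "('q, 'w) ring_scheme \<Rightarrow> ('k, 'z) ring_scheme
      \<Rightarrow> ('a, 'x) ring_scheme \<Rightarrow> ('a \<Rightarrow> 'k) \<Rightarrow> ('b, 'y) ring_scheme \<Rightarrow> ('b \<Rightarrow> 'k) \<Rightarrow> bool" where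
  "is_connected_sum Q k R pR S pS \<longleftrightarrow>
     connected_summand k R pR \<and> connected_summand k S pS \<and>
     (\<exists>\<delta>R \<in> carrier R. \<exists>\<delta>S \<in> carrier S.
        soc R = PIdl\<^bsub>R\<^esub> \<delta>R \<and> soc S = PIdl\<^bsub>S\<^esub> \<delta>S \<and>
        Q \<simeq> connected_sum R pR \<delta>R S pS \<delta>S)"

text \<open>The natural projection from a quotient \<open>T / J\<close> of a local ring \<open>(T, m)\<close> onto \<open>T / m\<close>: it sends
  the coset \<open>J + x\<close> to \<open>m + (J + x) = m + x\<close>, for a proper ideal \<open>J\<close>.\<close>

definition residue_proj :: "('a, 'b) ring_scheme \<Rightarrow> 'a set \<Rightarrow> 'a set" where
  "residue_proj T C = max_ideal T <+>\<^bsub>T\<^esub> C"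

end

theory Submission
  imports Defs
begin

text \<open>
Write \<open>T = Qt\<close>, \<open>\<mm>\<close> for its maximal ideal, \<open>I = I_Q\<close>, and \<open>\<langle>Y\<rangle>\<close>, \<open>\<langle>Z\<rangle>\<close> for the two ideals
generated by the two blocks of the regular system of parameters.

Everything rests on the inclusion \<open>\<langle>Y\<rangle> \<inter> \<langle>Z\<rangle> \<subseteq> I\<close> (\<open>regular_parameters_inter_subset\<close>). It holds
because any subset of a regular system of parameters generates a prime ideal
(\<open>regular_modulo_primeideal\<close>), so that every parameter is a nonzerodivisor modulo the ideal generated
by some of the others. An element of the intersection is a combination of the \<open>Y\<^sub>i\<close>; the coefficient
of one \<open>Y\<^sub>i\<close> can be moved into \<open>\<langle>Z\<rangle>\<close> modulo the remaining \<open>Y\<^sub>j\<close>, which splits off a term in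
\<open>Y\<^sub>i \<langle>Z\<rangle> \<subseteq> I\<close>, and so on until no \<open>Y\<^sub>i\<close> is left.

As regularity means that the length of the longest chain of primes equals the number of parameters,
primality of these ideals needs some dimension theory. Krull's principal ideal theorem, in the form
\<open>ex_prime_strictly_between_containing\<close>, makes it possible to push a given \<open>x \<in> \<mm>\<close> down a chain of
primes into its second member. Passing to the ideal generated by \<open>x\<close> therefore costs one generator and one step
of the chain. This bounds the length of a chain by the number of generators (\<open>krull_height_bound\<close>),
and in the case of equality an induction shows that the ideal at the bottom is prime.

Given the inclusion, \<open>J_R \<inter> \<langle>Y\<rangle> = I \<inter> \<langle>Y\<rangle>\<close> follows by the modular law. The image of \<open>\<langle>Y\<rangle>\<close> in \<open>Q\<close>
is nonzero, since \<open>I \<subseteq> \<mm>\<^sup>2\<close> contains no parameter; so it meets, and hence contains, the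
one-dimensional socle of \<open>Q\<close>. Thus the socle is generated by some \<open>d \<in> \<langle>Y\<rangle>\<close>, and likewise by some
\<open>e \<in> \<langle>Z\<rangle>\<close>, which a unit factor makes congruent to \<open>d\<close> modulo \<open>I\<close>. An element of \<open>\<langle>Y\<rangle>\<close> is killed by \<open>\<mm>\<close>
modulo \<open>J_R\<close> iff it is killed by \<open>\<mm>\<close> modulo \<open>I\<close>, so that \<open>d\<close> generates the socle of \<open>R = T / J_R\<close>
(\<open>socle_generator_J\<close>), and \<open>e\<close> that of \<open>S = T / J_S\<close>.

Finally \<open>t \<mapsto> (t + J_R, t + J_S)\<close> maps \<open>T\<close> onto the fibre product, because \<open>\<mm> = J_R + J_S\<close>, with kernel
\<open>J_R \<inter> J_S\<close> (\<open>fibre_product_quotients\<close>). As \<open>d \<in> J_S\<close> and \<open>e \<in> J_R\<close>, it sends \<open>d - e\<close> to the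
difference of the two socle generators, and \<open>I = \<langle>d - e\<rangle> + (J_R \<inter> J_S)\<close>
(\<open>I_eq_Idl_insert_inter\<close>). Hence \<open>T / I\<close> is the connected sum.
\<close>

section \<open>Ideals in Noetherian rings\<close>

locale noetherian_cring = cring R + noetherian_ring R for R (structure)

lemma ideal_subset_carrier: "ideal J R \<Longrightarrow> J \<subseteq> carrier R"
  using ideal.Icarr by (rule subsetI)

lemma (in cring) cring_idealI:
  assumes "K \<subseteq> carrier R" "\<zero> \<in> K"
    and "\<And>a b. a \<in> K \<Longrightarrow> b \<in> K \<Longrightarrow> a \<oplus> b \<in> K"
    and mult: "\<And>a x. a \<in> K \<Longrightarrow> x \<in> carrier R \<Longrightarrow> x \<otimes> a \<in> K"
  shows "ideal K R"
proof (rule idealI[OF ring_axioms])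
  show "subgroup K (add_monoid R)"
  proof (rule add.subgroupI)
    fix a assume "a \<in> K"
    moreover from this have "\<ominus> a = (\<ominus> \<one>) \<otimes> a"
      using assms(1) l_minus l_one one_closed by (metis subsetD)
    ultimately show "\<ominus> a \<in> K"
      using mult by auto
  qed (use assms in auto)
  show "a \<otimes> x \<in> K" if "a \<in> K" "x \<in> carrier R" for a x
    using that assms(1) mult m_comm by (metis subsetD)
qed (use mult in auto)

lemma (in cring) mem_Idl_insert:
  assumes J: "ideal J R" and x: "x \<in> carrier R"
  shows "a \<in> Idl (insert x J) \<longleftrightarrow> (\<exists>c \<in> carrier R. \<exists>b \<in> J. a = c \<otimes> x \<oplus> b)"
proof -
  interpret J: ideal J R by (rule J)
  let ?K = "{c \<otimes> x \<oplus> b | c b. c \<in> carrier R \<and> b \<in> J}"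
  have K: "ideal ?K R"
  proof (rule cring_idealI)
    show "?K \<subseteq> carrier R" using x by auto
    have "\<zero> = \<zero> \<otimes> x \<oplus> \<zero>" using x by simp
    then show "\<zero> \<in> ?K" by (blast intro: J.zero_closed)
  next
    fix a b assume "a \<in> ?K" "b \<in> ?K"
    then obtain c d c' d' where *: "c \<in> carrier R" "d \<in> J" "c' \<in> carrier R" "d' \<in> J"
      "a = c \<otimes> x \<oplus> d" "b = c' \<otimes> x \<oplus> d'" by blast
    moreover have "a \<oplus> b = (c \<oplus> c') \<otimes> x \<oplus> (d \<oplus> d')"
      using * x J.Icarr[OF *(2)] J.Icarr[OF *(4)] by algebra
    ultimately show "a \<oplus> b \<in> ?K" by blast
  next
    fix a b assume b: "b \<in> carrier R" and "a \<in> ?K"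
    then obtain c d where *: "c \<in> carrier R" "d \<in> J" "a = c \<otimes> x \<oplus> d" by blast
    have "b \<otimes> a = (b \<otimes> c) \<otimes> x \<oplus> b \<otimes> d"
      using * b x J.Icarr[OF *(2)] by algebra
    then show "b \<otimes> a \<in> ?K" using b * J.I_l_closed by blast
  qed
  have "x = \<one> \<otimes> x \<oplus> \<zero>" using x by simp
  moreover have "b = \<zero> \<otimes> x \<oplus> b" if "b \<in> J" for b using that x by simp
  ultimately have "insert x J \<subseteq> ?K" by (blast intro: J.zero_closed)
  then have "Idl (insert x J) \<subseteq> ?K" by (rule genideal_minimal[OF K])
  moreover have "?K \<subseteq> Idl (insert x J)"
  proof -
    have "insert x J \<subseteq> carrier R" using x J.a_subset by blast
    then interpret G: ideal "Idl (insert x J)" R by (rule genideal_ideal)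
    have "insert x J \<subseteq> Idl (insert x J)"
      using \<open>insert x J \<subseteq> carrier R\<close> by (rule genideal_self)
    then show ?thesis using G.I_l_closed by blast
  qed
  ultimately show ?thesis by blast
qed

lemma (in ring) Idl_union_Idl:
  assumes "A \<subseteq> carrier R" "B \<subseteq> carrier R"
  shows "Idl (A \<union> Idl B) = Idl (A \<union> B)"
proof (rule antisym)
  have "A \<union> B \<subseteq> carrier R" using assms by blast
  then have AB: "ideal (Idl (A \<union> B)) R" "A \<union> B \<subseteq> Idl (A \<union> B)"
    using genideal_ideal genideal_self by blast+
  then show "Idl (A \<union> Idl B) \<subseteq> Idl (A \<union> B)"
    by (intro genideal_minimal) (use AB genideal_minimal in auto)
  interpret B: ideal "Idl B" R using assms genideal_ideal by auto
  show "Idl (A \<union> B) \<subseteq> Idl (A \<union> Idl B)"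
    by (rule subset_Idl_subset) (use assms B.a_subset genideal_self in blast)+
qed

lemma (in ideal) minus_closed: "\<lbrakk>a \<in> I; b \<in> I\<rbrakk> \<Longrightarrow> a \<ominus> b \<in> I"
  by (simp add: a_minus_def)

lemma (in ring) Idl_ideal: "ideal J R \<Longrightarrow> Idl J = J"
  by (meson genideal_minimal genideal_self ideal.Icarr subsetI subset_antisym)

lemma (in ring) ideal_prod_subset:
  assumes "ideal K R" "\<And>i j. i \<in> I \<Longrightarrow> j \<in> J \<Longrightarrow> i \<otimes> j \<in> K"
  shows "I \<cdot> J \<subseteq> K"
proof
  interpret K: ideal K R by fact
  fix x assume "x \<in> I \<cdot> J"
  then show "x \<in> K" by (induction rule: ideal_prod.induct) (use assms(2) K.a_closed in auto)
qed

lemma (in ring) ideal_pow_Suc_subset: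
  assumes "ideal I R"
  shows "ideal_pow R I (Suc n) \<subseteq> I"
proof -
  interpret I: ideal I R by fact
  show ?thesis
  proof (induction n)
    case 0
    show ?case using ideal_prod_subset[OF assms I.I_l_closed] by simp
  next
    case (Suc n)
    have "ideal_pow R I (Suc n) \<cdot> I \<subseteq> I"
      using Suc by (intro ideal_prod_subset[OF assms I.I_l_closed] I.Icarr) auto
    then show ?case by simp
  qed
qed

lemma (in noetherian_ring) ex_maximal_ideal_in_family:
  assumes "C \<noteq> {}" "\<And>K. K \<in> C \<Longrightarrow> ideal K R"
  obtains M where "M \<in> C" "\<And>K. K \<in> C \<Longrightarrow> M \<subseteq> K \<Longrightarrow> K = M"
proof -
  have "\<exists>M \<in> C. \<forall>K \<in> C. M \<subseteq> K \<longrightarrow> K = M"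
  proof (rule subset_Zorn)
    fix D assume D: "subset.chain C D"
    show "\<exists>U \<in> C. \<forall>K \<in> D. K \<subseteq> U"
    proof (cases "D = {}")
      case True
      then show ?thesis using assms(1) by blast
    next
      case False
      have "subset.chain {I. ideal I R} D"
        using D assms(2) unfolding pred_on.chain_def by blast
      then have "\<Union>D \<in> D" using False ideal_chain_is_trivial by blast
      moreover have "D \<subseteq> C" using D unfolding pred_on.chain_def by simp
      ultimately show ?thesis by (intro bexI[of _ "\<Union>D"]) auto
    qed
  qed
  then show thesis using that by blast
qed

text \<open>A maximal member among the annihilators of the nonzero elements of \<open>(L + K) / K\<close> is prime: this is
the existence of associated primes.\<close>

lemma (in noetherian_cring) ex_prime_colon:
  assumes K: "ideal K R" and L: "ideal L R" and nsub: "\<not> L \<subseteq> K"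
  obtains g where "g \<in> L" "g \<notin> K" "primeideal {a \<in> carrier R. a \<otimes> g \<in> K} R"
proof -
  interpret K: ideal K R by (rule K)
  interpret L: ideal L R by (rule L)
  define colon where "colon g = {a \<in> carrier R. a \<otimes> g \<in> K}" for g
  have colon: "ideal (colon g) R" if "g \<in> L" for g
    by (rule cring_idealI) (use that L.Icarr K.I_l_closed in \<open>auto simp: colon_def l_distr m_assoc\<close>)
  obtain M where M: "M \<in> colon ` (L - K)" "\<And>N. N \<in> colon ` (L - K) \<Longrightarrow> M \<subseteq> N \<Longrightarrow> N = M"
    by (rule ex_maximal_ideal_in_family[of "colon ` (L - K)"]) (use nsub colon in auto)
  from M(1) obtain g where g: "g \<in> L" "g \<notin> K" "M = colon g" by blast
  have gc: "g \<in> carrier R" using g L.Icarr by blast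
  have "primeideal (colon g) R"
  proof (rule primeidealI)
    show "ideal (colon g) R" using colon g by blast
    show "cring R" by (rule is_cring)
    have "\<one> \<notin> colon g" using g gc unfolding colon_def by simp
    then show "carrier R \<noteq> colon g" by blast
  next
    fix a b assume ab: "a \<in> carrier R" "b \<in> carrier R" "a \<otimes> b \<in> colon g"
    show "a \<in> colon g \<or> b \<in> colon g"
    proof (cases "a \<in> colon g")
      case False
      then have "a \<otimes> g \<in> L - K" using ab g L.I_l_closed unfolding colon_def by blast
      moreover have "colon g \<subseteq> colon (a \<otimes> g)"
        using ab gc K.I_l_closed m_lcomm[of _ a g] unfolding colon_def by auto
      ultimately have "colon (a \<otimes> g) = colon g" using M(2) g(3) by blast
      moreover have "b \<otimes> (a \<otimes> g) = (a \<otimes> b) \<otimes> g" using ab gc by algebra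
      then have "b \<in> colon (a \<otimes> g)" using ab unfolding colon_def by simp
      ultimately show ?thesis by blast
    qed blast
  qed
  then show thesis using that g unfolding colon_def by blast
qed

section \<open>Saturation at a prime\<close>

text \<open>For a prime \<open>P\<close> this is the contraction of the extension of \<open>K\<close> to the localisation at \<open>P\<close>.
Arguing with saturated ideals replaces localising.\<close>

definition (in ring) saturation :: "'a set \<Rightarrow> 'a set \<Rightarrow> 'a set" where
  "saturation P K = {a \<in> carrier R. \<exists>s \<in> carrier R - P. s \<otimes> a \<in> K}"

lemma (in ring) saturation_mono: "K \<subseteq> L \<Longrightarrow> saturation P K \<subseteq> saturation P L"
  unfolding saturation_def by blast

lemma (in primeideal) one_notin: "\<one> \<notin> I"
  using I_notcarr one_imp_carrier by blast

lemma (in primeideal) mult_notin: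
  "\<lbrakk>a \<in> carrier R - I; b \<in> carrier R - I\<rbrakk> \<Longrightarrow> a \<otimes> b \<in> carrier R - I"
  using I_prime by auto

context cring
begin

context
  fixes P assumes P: "primeideal P R"
begin

interpretation P: primeideal P R by (rule P)

lemma saturation_superset: "ideal K R \<Longrightarrow> K \<subseteq> saturation P K"
proof
  fix a assume "ideal K R" "a \<in> K"
  then have "a \<in> carrier R" "\<one> \<otimes> a \<in> K" using ideal.Icarr by fastforce+
  then show "a \<in> saturation P K" unfolding saturation_def using P.one_notin by blast
qed

lemma saturation_ideal:
  assumes K: "ideal K R"
  shows "ideal (saturation P K) R"
proof (rule cring_idealI)
  interpret K: ideal K R by (rule K)
  show "\<zero> \<in> saturation P K" using saturation_superset[OF K] K.zero_closed by blast
  show "saturation P K \<subseteq> carrier R" unfolding saturation_def by blast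
  fix a assume "a \<in> saturation P K"
  then obtain s where s: "a \<in> carrier R" "s \<in> carrier R - P" "s \<otimes> a \<in> K"
    unfolding saturation_def by blast
  {
    fix x assume x: "x \<in> carrier R"
    have "s \<otimes> (x \<otimes> a) = x \<otimes> (s \<otimes> a)" using s x by (simp add: m_lcomm)
    moreover have "x \<otimes> (s \<otimes> a) \<in> K" using s x K.I_l_closed by blast
    ultimately have "s \<otimes> (x \<otimes> a) \<in> K" by simp
    then show "x \<otimes> a \<in> saturation P K"
      using s x unfolding saturation_def by blast
  next
    fix b assume "b \<in> saturation P K"
    then obtain t where t: "b \<in> carrier R" "t \<in> carrier R - P" "t \<otimes> b \<in> K"
      unfolding saturation_def by blast
    have "(s \<otimes> t) \<otimes> (a \<oplus> b) = t \<otimes> (s \<otimes> a) \<oplus> s \<otimes> (t \<otimes> b)"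
      using s(1) t(1) DiffD1[OF s(2)] DiffD1[OF t(2)] by algebra
    then have "(s \<otimes> t) \<otimes> (a \<oplus> b) \<in> K" using s t K.I_l_closed by auto
    then show "a \<oplus> b \<in> saturation P K"
      using s t P.mult_notin[of s t] unfolding saturation_def by blast
  }
qed

lemma saturation_cancel:
  assumes "s \<in> carrier R - P" "a \<in> carrier R" "s \<otimes> a \<in> saturation P K"
  shows "a \<in> saturation P K"
proof -
  obtain t where t: "t \<in> carrier R - P" "t \<otimes> (s \<otimes> a) \<in> K"
    using assms(3) unfolding saturation_def by blast
  then have "(t \<otimes> s) \<otimes> a \<in> K" using assms by (simp add: m_assoc)
  then show ?thesis
    using P.mult_notin[OF t(1) assms(1)] assms(2) unfolding saturation_def by blast
qed

lemma saturation_idem: "saturation P (saturation P K) = saturation P K"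
proof
  show "saturation P (saturation P K) \<subseteq> saturation P K"
  proof
    fix a assume "a \<in> saturation P (saturation P K)"
    then obtain s where "a \<in> carrier R" "s \<in> carrier R - P" "s \<otimes> a \<in> saturation P K"
      unfolding saturation_def by blast
    then show "a \<in> saturation P K" using saturation_cancel by blast
  qed
  show "saturation P K \<subseteq> saturation P (saturation P K)"
  proof
    fix a assume "a \<in> saturation P K"
    moreover from this have "a \<in> carrier R" unfolding saturation_def by blast
    moreover from this have "\<one> \<otimes> a \<in> saturation P K" using calculation by simp
    ultimately show "a \<in> saturation P (saturation P K)"
      using P.one_notin unfolding saturation_def[of _ "saturation P K"] by blast
  qed
qed

text \<open>Nakayama's lemma in the localisation at \<open>P\<close>: from \<open>K = Q + x K\<close> there, with \<open>x \<in> P\<close>, follows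
\<open>K = Q\<close> there. The proof discards the generators of \<open>K\<close> one at a time.\<close>

lemma nakayama_at_prime:
  assumes "noetherian_ring R" and K: "ideal K R" and Q: "ideal Q R" "Q \<subseteq> K" and x: "x \<in> P"
    and eq: "\<And>k. k \<in> K \<Longrightarrow> \<exists>s \<in> carrier R - P. \<exists>q \<in> Q. \<exists>k' \<in> K. s \<otimes> k = q \<oplus> x \<otimes> k'"
  shows "K \<subseteq> saturation P Q"
proof -
  interpret N: noetherian_ring R by fact
  interpret K: ideal K R by (rule K)
  interpret Q: ideal Q R by (rule Q(1))
  have xc: "x \<in> carrier R" using x by (rule P.Icarr)
  have "K \<subseteq> saturation P Q"
    if "finite A" "A \<subseteq> K" "K \<subseteq> saturation P (Idl (A \<union> Q))" for A
    using that
  proof (induction A)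
    case empty
    then show ?case using Idl_ideal[OF Q(1)] by simp
  next
    case (insert g A)
    define B where "B = Idl (A \<union> Q)"
    have AQ: "A \<union> Q \<subseteq> carrier R" using insert.prems Q.a_subset K.a_subset by auto
    interpret B: ideal B R unfolding B_def using AQ by (rule genideal_ideal)
    have QB: "Q \<subseteq> B" unfolding B_def using genideal_self[OF AQ] by blast
    have g: "g \<in> K" "g \<in> carrier R" using insert.prems K.Icarr by auto
    have Kg: "K \<subseteq> saturation P (Idl (insert g B))"
      using insert.prems(2) Idl_union_Idl[of "{g}", OF _ AQ] g unfolding B_def by simp
    have KgE: "\<exists>t \<in> carrier R - P. \<exists>c \<in> carrier R. \<exists>b \<in> B. t \<otimes> k = c \<otimes> g \<oplus> b" if "k \<in> K" for k
      using Kg that mem_Idl_insert[OF B.is_ideal g(2)] unfolding saturation_def by blast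
    obtain s q k' where s: "s \<in> carrier R - P" "q \<in> Q" "k' \<in> K" "s \<otimes> g = q \<oplus> x \<otimes> k'"
      using eq[OF g(1)] by blast
    obtain t c b where t: "t \<in> carrier R - P" "c \<in> carrier R" "b \<in> B" "t \<otimes> k' = c \<otimes> g \<oplus> b"
      using KgE[OF s(3)] by blast
    \<comment> \<open>Absorbing the multiple of \<open>g\<close> on the right: \<open>u\<close> is a unit at \<open>P\<close>, because \<open>x \<in> P\<close>.\<close>
    define u where "u = t \<otimes> s \<ominus> x \<otimes> c"
    have carr: "t \<in> carrier R" "s \<in> carrier R" "c \<in> carrier R" "q \<in> carrier R" "b \<in> carrier R"
      "k' \<in> carrier R"
      using s t K.Icarr Q.Icarr B.Icarr by auto
    have uc: "u \<in> carrier R" unfolding u_def using carr xc by simp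
    have "u \<notin> P"
    proof
      assume "u \<in> P"
      moreover have "t \<otimes> s = u \<oplus> c \<otimes> x" unfolding u_def using carr xc by algebra
      ultimately have "t \<otimes> s \<in> P" using P.I_l_closed[OF x carr(3)] P.a_closed by simp
      then show False using P.mult_notin[OF t(1) s(1)] by blast
    qed
    have "u \<otimes> g = t \<otimes> (s \<otimes> g) \<ominus> x \<otimes> (c \<otimes> g)" unfolding u_def using carr xc g by algebra
    also have "\<dots> = t \<otimes> q \<oplus> x \<otimes> (t \<otimes> k') \<ominus> x \<otimes> (c \<otimes> g)"
      unfolding s(4) using carr xc g by algebra
    also have "\<dots> = t \<otimes> q \<oplus> x \<otimes> b" unfolding t(4) using carr xc g by algebra
    finally have ug: "u \<otimes> g \<in> B"
      using carr xc s(2) t(3) QB B.I_l_closed B.a_closed by (metis subsetD)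
    have "K \<subseteq> saturation P B"
    proof
      fix k assume k: "k \<in> K"
      obtain t c b where t: "t \<in> carrier R - P" "c \<in> carrier R" "b \<in> B" "t \<otimes> k = c \<otimes> g \<oplus> b"
        using KgE[OF k] by blast
      have kc: "k \<in> carrier R" "b \<in> carrier R" "t \<in> carrier R" using k K.Icarr t B.Icarr by auto
      have "(u \<otimes> t) \<otimes> k = u \<otimes> (t \<otimes> k)" using uc kc by (simp add: m_assoc)
      also have "\<dots> = c \<otimes> (u \<otimes> g) \<oplus> u \<otimes> b"
        unfolding t(4) using kc t(2) uc g by algebra
      finally have "(u \<otimes> t) \<otimes> k \<in> B" using ug t uc B.I_l_closed by auto
      then show "k \<in> saturation P B"
        using P.mult_notin[OF _ t(1)] uc \<open>u \<notin> P\<close> kc unfolding saturation_def by blast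
    qed
    then show ?case using insert.IH insert.prems unfolding B_def by blast
  qed
  moreover obtain A where A: "finite A" "A \<subseteq> carrier R" "K = Idl A"
    using N.finetely_gen[OF K] by blast
  moreover have "A \<subseteq> K" using A genideal_self by blast
  moreover have "K \<subseteq> saturation P (Idl (A \<union> Q))"
  proof -
    have "A \<union> Q \<subseteq> carrier R" using A Q.a_subset by auto
    then have "K \<subseteq> Idl (A \<union> Q)" "ideal (Idl (A \<union> Q)) R"
      unfolding A(3) using subset_Idl_subset genideal_ideal by auto
    then show ?thesis using saturation_superset by blast
  qed
  ultimately show ?thesis by blast
qed

end
end

text \<open>If \<open>P\<close> is minimal over \<open>J\<close>, then the localisation of \<open>R / J\<close> at \<open>P\<close> is Artinian. To prove it
without composition series, take an ideal \<open>K\<close> that is maximal with the property that the sequence of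
the \<open>I n \<inter> K\<close> stabilises. If \<open>K\<close> were proper at \<open>P\<close>, then \<open>P\<close> would annihilate some \<open>g\<close> outside \<open>K\<close>
modulo \<open>K\<close> locally, and the one-dimensional step from \<open>K\<close> to \<open>K + \<langle>g\<rangle>\<close> would keep the property.\<close>

lemma (in noetherian_cring) saturated_chain_stabilises:
  assumes P: "primeideal P R" and J: "ideal J R" "J \<subseteq> P"
    and min: "\<And>P'. primeideal P' R \<Longrightarrow> J \<subseteq> P' \<Longrightarrow> P' \<subseteq> P \<Longrightarrow> P' = P"
    and I: "\<And>n::nat. ideal (I n) R" "\<And>n. J \<subseteq> I n" "\<And>n. I (Suc n) \<subseteq> I n"
      "\<And>n. saturation P (I n) \<subseteq> I n"
  shows "\<exists>N. \<forall>n\<ge>N. I n = I N"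
proof -
  interpret P: primeideal P R by (rule P)
  have anti: "I n \<subseteq> I m" if "m \<le> n" for m n
    by (rule lift_Suc_antimono_le[OF _ that]) (rule I(3))
  have cancel: "a \<in> I n" if "a \<in> carrier R" "s \<in> carrier R - P" "s \<otimes> a \<in> I n" for a s n
    using I(4)[of n] that unfolding saturation_def by blast
  define C where "C = {K. ideal K R \<and> J \<subseteq> K \<and> (\<exists>N. \<forall>n\<ge>N. I N \<inter> K \<subseteq> I n)}"
  have "\<forall>n\<ge>0. I 0 \<inter> J \<subseteq> I n" using I(2) by blast
  then have "J \<in> C" unfolding C_def using J(1) by blast
  then have ne: "C \<noteq> {}" by blast
  have idl: "ideal K R" if "K \<in> C" for K using that unfolding C_def by blast
  obtain K where K: "K \<in> C" "\<And>L. L \<in> C \<Longrightarrow> K \<subseteq> L \<Longrightarrow> L = K"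
    using ex_maximal_ideal_in_family[OF ne idl] by metis
  from K(1) obtain N where Ki: "ideal K R" and JK: "J \<subseteq> K"
    and N: "\<And>n. n \<ge> N \<Longrightarrow> I N \<inter> K \<subseteq> I n" unfolding C_def by blast
  interpret K: ideal K R by (rule Ki)
  define K' where "K' = saturation P K"
  interpret K': ideal K' R unfolding K'_def by (rule saturation_ideal[OF P Ki])
  have "\<not> K \<subseteq> P"
  proof
    assume KP: "K \<subseteq> P"
    have "\<one> \<notin> K'" unfolding K'_def saturation_def using KP by auto
    then have "\<not> carrier R \<subseteq> K'" by blast
    then obtain g where g: "g \<in> carrier R" "g \<notin> K'" "primeideal {a \<in> carrier R. a \<otimes> g \<in> K'} R"
      using ex_prime_colon[OF K'.is_ideal oneideal] by blast
    have KK': "K \<subseteq> K'" unfolding K'_def by (rule saturation_superset[OF P Ki])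
    have "{a \<in> carrier R. a \<otimes> g \<in> K'} = P"
    proof (rule min[OF g(3)])
      show "J \<subseteq> {a \<in> carrier R. a \<otimes> g \<in> K'}"
        using JK KK' K'.I_r_closed g(1) K.Icarr by blast
      show "{a \<in> carrier R. a \<otimes> g \<in> K'} \<subseteq> P"
        using saturation_cancel[OF P] g unfolding K'_def by blast
    qed
    then have Pg: "a \<otimes> g \<in> K'" if "a \<in> P" for a using that by blast
    define L where "L = Idl (insert g K)"
    have gK: "insert g K \<subseteq> carrier R" using g K.a_subset by blast
    have KL: "insert g K \<subseteq> L" unfolding L_def using gK by (rule genideal_self)
    interpret L: ideal L R unfolding L_def using gK by (rule genideal_ideal)
    have LE: "\<exists>c \<in> carrier R. \<exists>b \<in> K. a = c \<otimes> g \<oplus> b" if "a \<in> L" for a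
      using that mem_Idl_insert[OF Ki g(1)] unfolding L_def by blast
    \<comment> \<open>Locally \<open>L / K\<close> has dimension one, so the image of \<open>I n \<inter> L\<close> in it is either zero for large \<open>n\<close>
      or everything for all \<open>n\<close>.\<close>
    have "\<exists>N'. \<forall>n\<ge>N'. I N' \<inter> L \<subseteq> I n"
    proof (cases "\<exists>M. I M \<inter> L \<subseteq> K'")
      case True
      then obtain M where M: "I M \<inter> L \<subseteq> K'" by blast
      have "I (max N M) \<inter> L \<subseteq> I n" if n: "n \<ge> max N M" for n
      proof
        fix a assume a: "a \<in> I (max N M) \<inter> L"
        then have "a \<in> K'" using M anti[of M "max N M"] by auto
        then obtain s where s: "s \<in> carrier R - P" "s \<otimes> a \<in> K" "a \<in> carrier R"
          unfolding K'_def saturation_def by blast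
        have "a \<in> I N" using a anti[of N "max N M"] by auto
        then have "s \<otimes> a \<in> I N" using s ideal.I_l_closed[OF I(1)] by blast
        then have "s \<otimes> a \<in> I n" using s N[of n] n by auto
        then show "a \<in> I n" using cancel s by blast
      qed
      then show ?thesis by blast
    next
      case False
      have "I N \<inter> L \<subseteq> I n" if n: "n \<ge> N" for n
      proof
        fix a assume a: "a \<in> I N \<inter> L"
        obtain b where b: "b \<in> I n" "b \<in> L" "b \<notin> K'" using False by blast
        obtain c k where c: "c \<in> carrier R" "k \<in> K" "a = c \<otimes> g \<oplus> k" using LE a by blast
        obtain d l where d: "d \<in> carrier R" "l \<in> K" "b = d \<otimes> g \<oplus> l" using LE b by blast
        have carr: "k \<in> carrier R" "l \<in> carrier R" "a \<in> carrier R" "b \<in> carrier R"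
          using c d K.Icarr L.Icarr a b by auto
        have dP: "d \<notin> P"
        proof
          assume "d \<in> P"
          then have "b \<in> K'" unfolding d(3) using Pg d(2) KK' K'.a_closed by blast
          then show False using b by blast
        qed
        \<comment> \<open>Eliminating \<open>g\<close> with the help of \<open>b \<in> I n\<close> leads back to \<open>K\<close>, where the sequence is stable.\<close>
        have "d \<otimes> a \<ominus> c \<otimes> b = d \<otimes> k \<ominus> c \<otimes> l"
          unfolding c(3) d(3) using c(1) d(1) carr g(1) by algebra
        then have "d \<otimes> a \<ominus> c \<otimes> b \<in> K"
          using c d K.I_l_closed K.minus_closed by auto
        moreover have "d \<otimes> a \<ominus> c \<otimes> b \<in> I N"
          using a b(1) anti[OF n] c(1) d(1) ideal.I_l_closed[OF I(1)]
            ideal.minus_closed[OF I(1)] by blast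
        ultimately have "d \<otimes> a \<ominus> c \<otimes> b \<in> I n" using N[OF n] by blast
        moreover have "c \<otimes> b \<in> I n" using b(1) c(1) ideal.I_l_closed[OF I(1)] by blast
        moreover have "d \<otimes> a = (d \<otimes> a \<ominus> c \<otimes> b) \<oplus> c \<otimes> b"
          using carr c(1) d(1) by algebra
        ultimately have "d \<otimes> a \<in> I n"
          using additive_subgroup.a_closed[OF ideal.axioms(1)[OF I(1)]] by metis
        then show "a \<in> I n" using cancel dP d(1) carr by blast
      qed
      then show ?thesis by blast
    qed
    then have "L \<in> C" unfolding C_def using L.is_ideal KL JK by blast
    then have "L = K" using K(2) KL by blast
    then show False using KL g(2) KK' by blast
  qed
  then obtain s where s: "s \<in> K" "s \<in> carrier R - P" using K.Icarr by blast
  have "I n = I N" if n: "n \<ge> N" for n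
  proof
    show "I n \<subseteq> I N" using anti n .
    show "I N \<subseteq> I n"
    proof
      fix a assume a: "a \<in> I N"
      then have ac: "a \<in> carrier R" using ideal.Icarr[OF I(1)] by blast
      have "s \<otimes> a \<in> I N" using a s ideal.I_l_closed[OF I(1)] by blast
      moreover have "s \<otimes> a \<in> K" using K.I_r_closed s ac by blast
      ultimately have "s \<otimes> a \<in> I n" using N[OF n] by blast
      then show "a \<in> I n" using cancel s ac by blast
    qed
  qed
  then show ?thesis by blast
qed

section \<open>Krull's principal ideal theorem\<close>

text \<open>Otherwise \<open>P2\<close> is minimal over \<open>P0 + \<langle>x\<rangle>\<close>, that is, a principal ideal of the domain \<open>R / P0\<close> has a
minimal prime of height at least two, against Krull's principal ideal theorem. The
contradiction comes from the powers of some \<open>y \<in> P1 - P0\<close>, saturated at \<open>P1\<close>: modulo \<open>x\<close> they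
form a descending sequence that stabilises at \<open>P2\<close>, and Nakayama's lemma removes the \<open>x\<close>, because
\<open>x \<notin> P1\<close>.\<close>

lemma (in noetherian_cring) ex_prime_strictly_between_containing:
  assumes P0: "primeideal P0 R" and P1: "primeideal P1 R" and P2: "primeideal P2 R"
    and sub: "P0 \<subset> P1" "P1 \<subset> P2" and x: "x \<in> P2"
  shows "\<exists>P. primeideal P R \<and> x \<in> P \<and> P0 \<subset> P \<and> P \<subset> P2"
proof (rule ccontr)
  assume none: "\<not> ?thesis"
  interpret P0: primeideal P0 R by (rule P0)
  interpret P1: primeideal P1 R by (rule P1)
  interpret P2: primeideal P2 R by (rule P2)
  from none have none': "\<not> P \<subset> P2" if "primeideal P R" "x \<in> P" "P0 \<subset> P" for P
    using that by blast
  have x1: "x \<notin> P1" using none'[OF P1 _ sub(1)] sub(2) by blast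
  have xc: "x \<in> carrier R" using x by (rule P2.Icarr)
  define J where "J = Idl (insert x P0)"
  have ic: "insert x P0 \<subseteq> carrier R" using xc P0.a_subset by blast
  have J: "ideal J R" "insert x P0 \<subseteq> J"
    unfolding J_def using genideal_ideal[OF ic] genideal_self[OF ic] by blast+
  have JP: "J \<subseteq> P2" unfolding J_def using x sub P2.is_ideal by (intro genideal_minimal) auto
  have min: "P' = P2" if "primeideal P' R" "J \<subseteq> P'" "P' \<subseteq> P2" for P'
  proof -
    have "x \<in> P'" "P0 \<subseteq> P'" using that J(2) by auto
    moreover from this have "P0 \<noteq> P'" using x1 sub(1) by blast
    ultimately show ?thesis using none'[OF that(1)] that(3) by blast
  qed
  obtain y where y: "y \<in> P1" "y \<notin> P0" using sub by blast
  have yc: "y \<in> carrier R" using y P1.Icarr by blast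
  define A where "A n = Idl (insert (y [^] n) P0)" for n :: nat
  define B where "B n = saturation P1 (A n)" for n
  define I where "I n = saturation P2 (Idl (insert x (B n)))" for n
  have Ac: "insert (y [^] n) P0 \<subseteq> carrier R" for n :: nat using yc P0.a_subset by auto
  have A: "ideal (A n) R" "insert (y [^] n) P0 \<subseteq> A n" for n
    unfolding A_def using genideal_ideal[OF Ac] genideal_self[OF Ac] by blast+
  have B: "ideal (B n) R" "A n \<subseteq> B n" for n
    unfolding B_def using saturation_ideal[OF P1 A(1)] saturation_superset[OF P1 A(1)] by auto
  have Bc: "insert x (B n) \<subseteq> carrier R" for n
    using xc ideal.Icarr[OF B(1)] by auto
  have xB: "ideal (Idl (insert x (B n))) R" "insert x (B n) \<subseteq> Idl (insert x (B n))" for n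
    using genideal_ideal[OF Bc] genideal_self[OF Bc] by blast+
  have I: "ideal (I n) R" "insert x (B n) \<subseteq> I n" for n
    unfolding I_def using saturation_ideal[OF P2 xB(1)] subset_trans[OF xB(2) saturation_superset[OF P2 xB(1)]] by blast+
  have Adec: "A (Suc n) \<subseteq> A n" for n
  proof -
    have "y [^] Suc n \<in> A n"
      using A[of n] yc ideal.I_r_closed[of "A n" R "y [^] n" y] by simp
    then show ?thesis unfolding A_def[of "Suc n"]
      using A[of n] by (intro genideal_minimal) auto
  qed
  then have Bdec: "B (Suc n) \<subseteq> B n" for n unfolding B_def by (intro saturation_mono)
  have Idec: "I (Suc n) \<subseteq> I n" for n
    unfolding I_def by (intro saturation_mono subset_Idl_subset Bc) (use Bdec in blast)
  have "\<exists>N. \<forall>n\<ge>N. I n = I N"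
  proof (rule saturated_chain_stabilises[where I = I, OF P2 J(1) JP min I(1) _ Idec])
    show "J \<subseteq> I n" for n
      unfolding J_def by (rule genideal_minimal[OF I(1)]) (use I(2) B(2) A(2) in blast)
    show "saturation P2 (I n) \<subseteq> I n" for n
      unfolding I_def using saturation_idem[OF P2] by simp
  qed
  then obtain N where N: "I (Suc N) = I N" by (meson le_Suc_eq order_refl)
  have "B N \<subseteq> saturation P2 (B (Suc N))"
  proof (rule nakayama_at_prime[OF P2 noetherian_ring_axioms B(1) B(1) Bdec x])
    fix k assume k: "k \<in> B N"
    then have "k \<in> I (Suc N)" using I(2) N by blast
    then obtain s where s: "s \<in> carrier R - P2" "s \<otimes> k \<in> Idl (insert x (B (Suc N)))"
      unfolding I_def saturation_def by blast
    then obtain c b where c: "c \<in> carrier R" "b \<in> B (Suc N)" "s \<otimes> k = c \<otimes> x \<oplus> b"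
      using mem_Idl_insert[OF B(1) xc] by blast
    interpret BN: ideal "B N" R by (rule B(1))
    have carr: "k \<in> carrier R" "b \<in> carrier R" "s \<in> carrier R" "b \<in> B N"
      using k BN.Icarr subsetD[OF Bdec c(2)] s by blast+
    have "x \<otimes> c = s \<otimes> k \<ominus> b" using carr c(1,3) xc by algebra
    then have "x \<otimes> c \<in> B N" using carr k BN.I_l_closed BN.minus_closed by auto
    then have "c \<in> B N" unfolding B_def
      using saturation_cancel[OF P1] x1 xc c(1) by blast
    moreover have "s \<otimes> k = b \<oplus> x \<otimes> c" using carr c xc by algebra
    ultimately show "\<exists>s\<in>carrier R - P2. \<exists>q\<in>B (Suc N). \<exists>k'\<in>B N. s \<otimes> k = q \<oplus> x \<otimes> k'"
      using s c by blast
  qed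
  also have "\<dots> \<subseteq> saturation P1 (B (Suc N))"
    unfolding saturation_def using sub by blast
  also have "\<dots> = B (Suc N)" unfolding B_def by (rule saturation_idem[OF P1])
  finally have "y [^] N \<in> saturation P1 (A (Suc N))"
    using A(2)[of N] B(2)[of N] unfolding B_def by blast
  then obtain s where s: "s \<in> carrier R - P1" "s \<otimes> y [^] N \<in> A (Suc N)"
    unfolding saturation_def by blast
  obtain c b where c: "c \<in> carrier R" "b \<in> P0" "s \<otimes> y [^] N = c \<otimes> y [^] Suc N \<oplus> b"
    using s(2) mem_Idl_insert[OF P0.is_ideal nat_pow_closed[OF yc]] unfolding A_def by blast
  have carr: "s \<in> carrier R" "b \<in> carrier R" "y [^] N \<in> carrier R" using s c P0.Icarr yc by auto
  \<comment> \<open>At \<open>P1\<close> the power \<open>y\<^sup>N\<close> is now a multiple of \<open>y\<^sup>N\<^sup>+\<^sup>1\<close> modulo \<open>P0\<close>, where \<open>s - c y\<close> is a unit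
    because \<open>y \<in> P1\<close>; this forces \<open>y\<^sup>N\<close> into \<open>P0\<close>.\<close>
  have "(s \<ominus> c \<otimes> y) \<otimes> y [^] N = s \<otimes> y [^] N \<ominus> c \<otimes> (y [^] N \<otimes> y)" using carr c(1) yc by algebra
  also have "\<dots> = b" unfolding c(3) nat_pow_Suc using carr c(1) yc by algebra
  finally have "s \<ominus> c \<otimes> y \<in> P0 \<or> y [^] N \<in> P0"
    using P0.I_prime carr c(1,2) yc by auto
  moreover have "y [^] n \<notin> P0" for n :: nat
  proof (induction n)
    case 0
    then show ?case using P0.one_notin by simp
  next
    case (Suc n)
    then show ?case using P0.mult_notin[of "y [^] n" y] y yc by simp
  qed
  moreover have "s \<ominus> c \<otimes> y \<notin> P0"
  proof
    assume "s \<ominus> c \<otimes> y \<in> P0"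
    then have "(s \<ominus> c \<otimes> y) \<oplus> c \<otimes> y \<in> P1" using sub y c(1) P1.I_l_closed by auto
    moreover have "(s \<ominus> c \<otimes> y) \<oplus> c \<otimes> y = s" using carr c(1) yc by algebra
    ultimately show False using s by simp
  qed
  ultimately show False by blast
qed

section \<open>Chains of primes and regular systems of parameters\<close>

definition prime_chain :: "('a, 'b) ring_scheme \<Rightarrow> (nat \<Rightarrow> 'a set) \<Rightarrow> nat \<Rightarrow> bool" where
  "prime_chain R P r \<longleftrightarrow> (\<forall>i\<le>r. primeideal (P i) R) \<and> (\<forall>i<r. P i \<subset> P (Suc i))"

lemma prime_chain_tl: "prime_chain R P (Suc r) \<Longrightarrow> prime_chain R (\<lambda>i. P (Suc i)) r"
  unfolding prime_chain_def by auto

lemma prime_chain_replace_last: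
  assumes "prime_chain R P (Suc r)" "primeideal p R" "P r \<subset> p"
  shows "prime_chain R (P(Suc r := p)) (Suc r)"
  using assms unfolding prime_chain_def by (auto simp: less_Suc_eq)

lemma prime_chain_append:
  assumes "prime_chain R P r" "primeideal p R" "P r \<subset> p"
  shows "prime_chain R (P(Suc r := p)) (Suc r)"
  using assms unfolding prime_chain_def by (auto simp: less_Suc_eq le_Suc_eq)

text \<open>Replace the members of the chain by primes containing \<open>x\<close>, from the top downwards, applying the
principal ideal theorem to three consecutive members each time.\<close>

lemma (in noetherian_cring) ex_prime_chain_second_containing:
  assumes "prime_chain R P (Suc r)" "x \<in> P (Suc r)"
  shows "\<exists>P'. prime_chain R P' (Suc r) \<and> P' 0 = P 0 \<and> P' (Suc r) = P (Suc r) \<and> x \<in> P' 1"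
  using assms
proof (induction r arbitrary: P)
  case 0
  then show ?case by auto
next
  case (Suc r)
  have "primeideal (P r) R" "primeideal (P (Suc r)) R" "primeideal (P (Suc (Suc r))) R"
    "P r \<subset> P (Suc r)" "P (Suc r) \<subset> P (Suc (Suc r))"
    using Suc.prems(1) unfolding prime_chain_def by auto
  from ex_prime_strictly_between_containing[OF this Suc.prems(2)]
  obtain p where p: "primeideal p R" "x \<in> p" "P r \<subset> p" "p \<subset> P (Suc (Suc r))" by blast
  \<comment> \<open>The chain below \<open>p\<close> is shorter by one, and its top contains \<open>x\<close>.\<close>
  have "prime_chain R P (Suc r)" using Suc.prems(1) unfolding prime_chain_def by auto
  then have "prime_chain R (P(Suc r := p)) (Suc r)"
    using prime_chain_replace_last[of R P r p] p by blast
  from Suc.IH[OF this] p(2) obtain P' where P': "prime_chain R P' (Suc r)" "P' 0 = P 0"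
    "P' (Suc r) = p" "x \<in> P' 1" by auto
  have "prime_chain R (P'(Suc (Suc r) := P (Suc (Suc r)))) (Suc (Suc r))"
    by (rule prime_chain_append[OF P'(1)])
      (use Suc.prems(1) P'(3) p(4) in \<open>auto simp: prime_chain_def\<close>)
  moreover have "(P'(Suc (Suc r) := P (Suc (Suc r)))) 0 = P 0"
    "(P'(Suc (Suc r) := P (Suc (Suc r)))) (Suc (Suc r)) = P (Suc (Suc r))"
    "x \<in> (P'(Suc (Suc r) := P (Suc (Suc r)))) 1"
    using P' by auto
  ultimately show ?case by blast
qed

sublocale local_ring \<subseteq> noetherian_cring ..

context local_ring
begin

lemma max_ideal_maximalideal: "maximalideal (max_ideal R) R"
  unfolding max_ideal_def by (rule theI'[OF unique_maximalideal])

lemma maximalideal_eq_max_ideal: "maximalideal N R \<Longrightarrow> N = max_ideal R"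
  using max_ideal_maximalideal unique_maximalideal by blast

lemma max_ideal_primeideal: "primeideal (max_ideal R) R"
  using max_ideal_maximalideal by (rule maximalideal_prime)

sublocale M: primeideal "max_ideal R" R
  by (rule max_ideal_primeideal)

lemma proper_ideal_subset_max_ideal:
  assumes "ideal K R" "\<one> \<notin> K"
  shows "K \<subseteq> max_ideal R"
proof -
  define C where "C = {L. ideal L R \<and> K \<subseteq> L \<and> \<one> \<notin> L}"
  have ne: "C \<noteq> {}" and idl: "\<And>L. L \<in> C \<Longrightarrow> ideal L R" unfolding C_def using assms by auto
  obtain N where N: "N \<in> C" "\<And>L. L \<in> C \<Longrightarrow> N \<subseteq> L \<Longrightarrow> L = N"
    using ex_maximal_ideal_in_family[OF ne idl] by metis
  have "maximalideal N R"
  proof (rule maximalidealI)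
    show "ideal N R" using N idl by blast
    show "carrier R \<noteq> N" using N one_closed unfolding C_def by blast
    fix L assume L: "ideal L R" "N \<subseteq> L" "L \<subseteq> carrier R"
    show "L = N \<or> L = carrier R"
      using N L ideal.one_imp_carrier[OF L(1)] unfolding C_def by blast
  qed
  then show ?thesis using N maximalideal_eq_max_ideal unfolding C_def by blast
qed

lemma unit_of_notin_max_ideal:
  assumes "a \<in> carrier R" "a \<notin> max_ideal R"
  shows "\<exists>b \<in> carrier R. b \<otimes> a = \<one>"
proof -
  have "\<one> \<in> PIdl a"
    using proper_ideal_subset_max_ideal[OF cgenideal_ideal] cgenideal_self assms by blast
  then show ?thesis unfolding cgenideal_def by auto
qed

lemma saturation_max_ideal:
  assumes K: "ideal K R"
  shows "saturation (max_ideal R) K = K"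
proof
  show "K \<subseteq> saturation (max_ideal R) K" by (rule saturation_superset[OF max_ideal_primeideal K])
  show "saturation (max_ideal R) K \<subseteq> K"
  proof
    fix a assume "a \<in> saturation (max_ideal R) K"
    then obtain s where s: "a \<in> carrier R" "s \<in> carrier R" "s \<notin> max_ideal R" "s \<otimes> a \<in> K"
      unfolding saturation_def by blast
    obtain t where t: "t \<in> carrier R" "t \<otimes> s = \<one>" using unit_of_notin_max_ideal s by blast
    have "t \<otimes> (s \<otimes> a) = a" using s t by (simp flip: m_assoc)
    then show "a \<in> K" using ideal.I_l_closed[OF K s(4) t(1)] by simp
  qed
qed

lemma ex_prime_chain_mod_generator:
  assumes "prime_chain R P (Suc r)" "J \<subseteq> P 0" "x \<in> max_ideal R"
  obtains P' where "prime_chain R P' (Suc r)" "J \<subseteq> P' 0" "x \<in> P' 1"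
proof -
  have "primeideal (P (Suc r)) R" using assms(1) unfolding prime_chain_def by blast
  then have "P (Suc r) \<subseteq> max_ideal R"
    using proper_ideal_subset_max_ideal primeideal.one_notin primeideal.axioms(1) by blast
  then have "P r \<subset> max_ideal R" using assms(1) unfolding prime_chain_def by blast
  then have "prime_chain R (P(Suc r := max_ideal R)) (Suc r)"
    using prime_chain_replace_last[OF assms(1) max_ideal_primeideal] by blast
  from ex_prime_chain_second_containing[OF this] assms(2,3) show thesis
    using that by fastforce
qed

lemma Idl_insert_union:
  assumes "ideal J R" "insert x G \<subseteq> carrier R"
  shows "Idl (Idl (insert x J) \<union> G) = Idl (J \<union> insert x G)"
proof -
  have "J \<subseteq> carrier R" using assms(1) by (rule ideal_subset_carrier)
  then have "Idl (G \<union> Idl (insert x J)) = Idl (G \<union> insert x J)"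
    using assms(2) by (intro Idl_union_Idl) auto
  then show ?thesis by (simp add: Un_commute)
qed

text \<open>Passing from \<open>J\<close> to \<open>J + \<langle>x\<rangle>\<close> removes a generator from \<open>G\<close> and, once the second member of the
chain contains \<open>x\<close>, only the bottom of the chain.\<close>

theorem krull_height_bound:
  assumes "finite G" "G \<subseteq> carrier R" "ideal J R" "max_ideal R = Idl (J \<union> G)"
    "prime_chain R P r" "J \<subseteq> P 0"
  shows "r \<le> card G"
  using assms
proof (induction G arbitrary: J P r rule: finite_induct)
  case empty
  have MJ: "max_ideal R = J" using empty Idl_ideal by simp
  show ?case
  proof (cases r)
    case (Suc r')
    then have "P 0 \<subset> P 1" "primeideal (P 1) R" using empty unfolding prime_chain_def by auto
    moreover from this have "P 1 \<subseteq> J"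
      using proper_ideal_subset_max_ideal primeideal.one_notin primeideal.axioms(1) MJ by blast
    ultimately show ?thesis using empty by blast
  qed simp
next
  case (insert x G)
  have xG: "J \<union> insert x G \<subseteq> carrier R"
    using insert.prems(1) ideal_subset_carrier[OF insert.prems(2)] by simp
  show ?case
  proof (cases r)
    case (Suc r')
    have x: "x \<in> max_ideal R" using insert.prems genideal_self[OF xG] by blast
    obtain P' where P': "prime_chain R P' (Suc r')" "J \<subseteq> P' 0" "x \<in> P' 1"
      using ex_prime_chain_mod_generator insert.prems(4,5) x unfolding Suc by metis
    define J' where "J' = Idl (insert x J)"
    have iJ': "ideal J' R" unfolding J'_def using xG by (intro genideal_ideal) auto
    have "primeideal (P' 1) R" "P' 0 \<subset> P' 1" using P'(1) unfolding prime_chain_def by auto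
    then have "J' \<subseteq> P' (Suc 0)" unfolding J'_def
      using P'(2,3) by (intro genideal_minimal) (auto intro: primeideal.axioms(1))
    moreover have "max_ideal R = Idl (J' \<union> G)"
      unfolding J'_def using Idl_insert_union insert.prems by metis
    ultimately have "r' \<le> card G"
      using insert.IH[OF _ iJ' _ prime_chain_tl[OF P'(1)]] insert.prems by blast
    then show ?thesis using Suc insert.hyps by simp
  qed simp
qed

text \<open>The ring \<open>R / J\<close> is a regular local ring and \<open>G\<close> maps to a regular system of parameters. Speaking
of ideals of \<open>R\<close> containing \<open>J\<close> keeps the ring fixed when \<open>J\<close> grows in an induction. By
\<open>krull_height_bound\<close> a chain of this length is as long as possible.\<close>

definition regular_modulo :: "'a set \<Rightarrow> 'a set \<Rightarrow> bool" where
  "regular_modulo J G \<longleftrightarrow> ideal J R \<and> finite G \<and> G \<subseteq> carrier R \<and> max_ideal R = Idl (J \<union> G) \<and>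
     (\<exists>P. prime_chain R P (card G) \<and> J \<subseteq> P 0)"

lemma regular_modulo_chain:
  assumes "regular_modulo J (insert x G)" "x \<notin> G"
  obtains P where "prime_chain R P (Suc (card G))" "J \<subseteq> P 0" "x \<in> P 1" "Idl (insert x J) \<subseteq> P 1"
proof -
  note A = assms(1)[unfolded regular_modulo_def]
  have "finite G" using A by simp
  then have c: "card (insert x G) = Suc (card G)" using assms(2) by simp
  have xG: "J \<union> insert x G \<subseteq> carrier R" using A ideal_subset_carrier[of J R] by simp
  have x: "x \<in> max_ideal R" using A genideal_self[OF xG] by blast
  obtain P where "prime_chain R P (Suc (card G))" "J \<subseteq> P 0" using A c by auto
  then obtain P' where P': "prime_chain R P' (Suc (card G))" "J \<subseteq> P' 0" "x \<in> P' 1"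
    using ex_prime_chain_mod_generator x by metis
  have "primeideal (P' 1) R" "P' 0 \<subset> P' 1" using P'(1) unfolding prime_chain_def by auto
  then have "Idl (insert x J) \<subseteq> P' 1"
    using P'(2,3) by (intro genideal_minimal) (auto intro: primeideal.axioms(1))
  then show thesis using that P' by blast
qed

text \<open>Dividing a regular local ring by a parameter gives a regular local ring.\<close>

lemma regular_modulo_insert:
  assumes "regular_modulo J (insert x G)" "x \<notin> G"
  shows "regular_modulo (Idl (insert x J)) G"
proof -
  note A = assms(1)[unfolded regular_modulo_def]
  have "insert x J \<subseteq> carrier R" using A ideal_subset_carrier[of J R] by simp
  then have "ideal (Idl (insert x J)) R" by (rule genideal_ideal)
  moreover have "max_ideal R = Idl (Idl (insert x J) \<union> G)"
    using Idl_insert_union A by metis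
  moreover obtain P where "prime_chain R P (Suc (card G))" "Idl (insert x J) \<subseteq> P 1"
    using regular_modulo_chain[OF assms] by metis
  then have "\<exists>P. prime_chain R P (card G) \<and> Idl (insert x J) \<subseteq> P 0"
    using prime_chain_tl by fastforce
  ultimately show ?thesis unfolding regular_modulo_def using A by simp
qed

lemma regular_modulo_notin:
  assumes "regular_modulo J (insert x G)" "x \<notin> G"
  shows "x \<notin> J"
proof
  assume "x \<in> J"
  note A = assms(1)[unfolded regular_modulo_def]
  have "J \<union> insert x G = J \<union> G" using \<open>x \<in> J\<close> by blast
  then have "card (insert x G) \<le> card G"
    using krull_height_bound[of G J] A by auto
  then show False using A assms(2) by simp
qed

text \<open>Regular local rings are domains. By induction \<open>J' = J + \<langle>x\<rangle>\<close> is prime, and the maximality of the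
length forces the second member of the chain to be \<open>J'\<close>. The bottom \<open>P 0\<close> does not contain \<open>x\<close>, so
that \<open>P 0 = J + x P 0\<close>, and by Nakayama's lemma the prime \<open>P 0\<close> is \<open>J\<close>.\<close>

theorem regular_modulo_primeideal:
  assumes "regular_modulo J G"
  shows "primeideal J R"
proof -
  have "finite G" using assms unfolding regular_modulo_def by blast
  then show ?thesis using assms
  proof (induction G arbitrary: J rule: finite_induct)
    case empty
    then have "max_ideal R = J" unfolding regular_modulo_def using Idl_ideal by simp
    then show ?case using max_ideal_primeideal by simp
  next
    case (insert x G)
    note A = insert.prems[unfolded regular_modulo_def]
    have Ji: "ideal J R" and xc: "x \<in> carrier R" using A by auto
    define J' where "J' = Idl (insert x J)"
    have J'r: "regular_modulo J' G"
      unfolding J'_def using regular_modulo_insert insert by blast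
    then have J'p: "primeideal J' R" by (rule insert.IH)
    obtain P where P: "prime_chain R P (Suc (card G))" "J \<subseteq> P 0" "x \<in> P 1" "J' \<subseteq> P 1"
      using regular_modulo_chain insert unfolding J'_def by metis
    have P1: "P 1 = J'"
    proof (rule ccontr)
      \<comment> \<open>Otherwise putting \<open>J'\<close> in place of \<open>P 0\<close> gives a chain over \<open>J'\<close> that is too long.\<close>
      assume "P 1 \<noteq> J'"
      then have "prime_chain R (P(0 := J')) (Suc (card G))"
        using P(1,4) J'p unfolding prime_chain_def by auto
      from krull_height_bound[OF _ _ _ _ this, of G J'] J'r
      show False unfolding regular_modulo_def by auto
    qed
    have P01: "P 0 \<subset> J'" "primeideal (P 0) R" using P(1) P1 unfolding prime_chain_def by auto
    interpret P0: primeideal "P 0" R by (rule P01)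
    have x0: "x \<notin> P 0"
    proof
      assume "x \<in> P 0"
      then have "J' \<subseteq> P 0" unfolding J'_def
        using P(2) by (intro genideal_minimal P0.is_ideal) auto
      then show False using P01 by blast
    qed
    have xM: "x \<in> max_ideal R"
    proof -
      have "J \<union> insert x G \<subseteq> carrier R" using A ideal_subset_carrier[of J R] by simp
      from genideal_self[OF this] show ?thesis using A by blast
    qed
    have "P 0 \<subseteq> saturation (max_ideal R) J"
    proof (rule nakayama_at_prime[OF max_ideal_primeideal noetherian_ring_axioms
            P0.is_ideal Ji P(2) xM])
      fix k assume k: "k \<in> P 0"
      then have "k \<in> Idl (insert x J)" using P01(1) unfolding J'_def by blast
      then obtain c b where c: "c \<in> carrier R" "b \<in> J" "k = c \<otimes> x \<oplus> b"
        unfolding mem_Idl_insert[OF Ji xc] by blast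
      have carr: "k \<in> carrier R" "b \<in> carrier R" "b \<in> P 0" using k c P(2) P0.Icarr by auto
      have "c \<otimes> x = k \<ominus> b" using c(1,3) carr xc by algebra
      then have "c \<otimes> x \<in> P 0" using P0.minus_closed k carr by simp
      then have "c \<in> P 0" using P0.I_prime c(1) xc x0 by blast
      moreover have "\<one> \<otimes> k = b \<oplus> x \<otimes> c" using c(1,3) carr xc by algebra
      ultimately show "\<exists>s\<in>carrier R - max_ideal R. \<exists>q\<in>J. \<exists>k'\<in>P 0. s \<otimes> k = q \<oplus> x \<otimes> k'"
        using c(2) M.one_notin by blast
    qed
    then have "P 0 = J" using saturation_max_ideal[OF Ji] P(2) by blast
    then show ?case using P01 by simp
  qed
qed

lemma regular_local_ring_regular_modulo:
  assumes "regular_local_ring R" "finite G" "G \<subseteq> carrier R" "max_ideal R = Idl G" "card G \<le> edim R"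
  shows "regular_modulo (Idl {}) G"
proof -
  define N where "N = {n. \<exists>P. prime_chain R P n}"
  have dim: "(SUP n \<in> N. enat n) = enat (edim R)"
    using assms(1) unfolding regular_local_ring_def krull_dim_def N_def prime_chain_def by blast
  have J: "ideal (Idl {}) R" by (rule genideal_ideal) simp
  have M: "max_ideal R = Idl (Idl {} \<union> G)"
    using Idl_union_Idl[OF assms(3), of "{}"] assms(4) by (simp add: Un_commute)
  have bound: "n \<le> card G" if "prime_chain R P n" for P n
  proof (rule krull_height_bound[OF assms(2,3) J M that])
    have "ideal (P 0) R" using that unfolding prime_chain_def by (blast intro: primeideal.axioms(1))
    then show "Idl {} \<subseteq> P 0" by (rule genideal_minimal) simp
  qed
  have "\<exists>n \<in> N. edim R \<le> n"
  proof (cases "edim R")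
    case 0
    have "prime_chain R (\<lambda>_. max_ideal R) 0"
      unfolding prime_chain_def using max_ideal_primeideal by simp
    then have "0 \<in> N" unfolding N_def by blast
    then show ?thesis using 0 by auto
  next
    case (Suc e)
    show ?thesis
    proof (rule ccontr)
      assume "\<not> ?thesis"
      then have "n \<le> e" if "n \<in> N" for n using that Suc by force
      then have "(SUP n \<in> N. enat n) \<le> enat e" by (intro SUP_least) simp
      then show False using dim Suc by simp
    qed
  qed
  then obtain n P where n: "edim R \<le> n" "prime_chain R P n" unfolding N_def by blast
  have "n = card G" using bound[OF n(2)] n(1) assms(5) by simp
  moreover have "ideal (P 0) R"
    using n(2) unfolding prime_chain_def by (blast intro: primeideal.axioms(1))
  then have "Idl {} \<subseteq> P 0" by (rule genideal_minimal) simp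
  ultimately show ?thesis unfolding regular_modulo_def using J M assms(2,3) n(2) by blast
qed

lemma regular_modulo_Idl_subset:
  assumes G: "regular_modulo (Idl {}) G" and "A \<subseteq> G"
  shows "regular_modulo (Idl A) (G - A)"
proof -
  have "finite G" "G \<subseteq> carrier R" using G unfolding regular_modulo_def by auto
  have "finite A" using \<open>finite G\<close> assms(2) by (rule rev_finite_subset)
  then show ?thesis using assms(2)
  proof (induction A rule: finite_induct)
    case empty
    then show ?case using G by simp
  next
    case (insert a A)
    then have "insert a (G - insert a A) = G - A" by auto
    then have "regular_modulo (Idl (insert a (Idl A))) (G - insert a A)"
      using regular_modulo_insert[of "Idl A" a "G - insert a A"] insert by auto
    moreover have "Idl ({a} \<union> Idl A) = Idl ({a} \<union> A)"
      using insert.prems \<open>G \<subseteq> carrier R\<close> by (intro Idl_union_Idl) auto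
    ultimately show ?case by simp
  qed
qed

text \<open>The elements of \<open>A\<close> are removed one at a time. If \<open>a = c y + a0\<close> lies in \<open>\<langle>B\<rangle>\<close>, then \<open>c y\<close> lies in the
prime ideal \<open>\<langle>A' \<union> B\<rangle>\<close>, which does not contain the parameter \<open>y\<close>; so \<open>c = b + z\<close> with \<open>b \<in> \<langle>A'\<rangle>\<close> and
\<open>z \<in> \<langle>B\<rangle>\<close>. Now \<open>z y \<in> I\<close>, and \<open>a - z y\<close> is an element of \<open>\<langle>A'\<rangle> \<inter> \<langle>B\<rangle>\<close>.\<close>

theorem regular_parameters_inter_subset:
  assumes G: "regular_modulo (Idl {}) (A \<union> B)" and disj: "A \<inter> B = {}" and I: "ideal I R"
    and AB: "\<And>a b. a \<in> A \<Longrightarrow> b \<in> B \<Longrightarrow> a \<otimes> b \<in> I"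
  shows "Idl A \<inter> Idl B \<subseteq> I"
proof -
  interpret I: ideal I R by (rule I)
  have fin: "finite A" and carr: "A \<subseteq> carrier R" "B \<subseteq> carrier R"
    using G unfolding regular_modulo_def by auto
  interpret B: ideal "Idl B" R using carr by (intro genideal_ideal)
  have yB: "z \<otimes> y \<in> I" if "y \<in> A" "z \<in> Idl B" for y z
  proof -
    have "y \<in> carrier R" using that carr by blast
    then have "ideal {z \<in> carrier R. y \<otimes> z \<in> I} R" by (rule I.helper_max_prime[OF is_cring])
    then have "Idl B \<subseteq> {z \<in> carrier R. y \<otimes> z \<in> I}"
      by (rule genideal_minimal) (use AB that carr in blast)
    then show ?thesis using that m_comm[OF \<open>y \<in> carrier R\<close>] by auto
  qed
  show ?thesis
    using fin order_refl[of A]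
  proof (induction rule: finite_subset_induct')
    case empty
    have "Idl {} \<subseteq> I" by (rule genideal_minimal[OF I]) simp
    then show ?case by blast
  next
    case (insert y A')
    have A'c: "A' \<subseteq> carrier R" and yc: "y \<in> carrier R" using insert carr by auto
    interpret A': ideal "Idl A'" R using A'c by (intro genideal_ideal)
    have "insert y (A \<union> B - insert y (A' \<union> B)) = A \<union> B - (A' \<union> B)"
      using insert disj by auto
    then have reg: "regular_modulo (Idl (A' \<union> B)) (insert y (A \<union> B - insert y (A' \<union> B)))"
      using regular_modulo_Idl_subset[OF G, of "A' \<union> B"] insert by auto
    then interpret AB: primeideal "Idl (A' \<union> B)" R by (rule regular_modulo_primeideal)
    have ynot: "y \<notin> Idl (A' \<union> B)" using regular_modulo_notin[OF reg] by blast
    have sum: "Idl (A' \<union> B) = Idl A' <+> Idl B"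
    proof -
      have "Idl A' <+> Idl B = Idl (Idl A' \<union> Idl B)"
        using union_genideal A'.is_ideal B.is_ideal by simp
      also have "\<dots> = Idl (Idl A' \<union> B)" using A'.a_subset carr by (intro Idl_union_Idl) auto
      also have "\<dots> = Idl (A' \<union> B)" using Idl_union_Idl[of B A'] A'c carr by (simp add: Un_commute)
      finally show ?thesis by simp
    qed
    show ?case
    proof
      fix a assume a: "a \<in> Idl (insert y A') \<inter> Idl B"
      have "Idl ({y} \<union> Idl A') = Idl ({y} \<union> A')" using A'c yc by (intro Idl_union_Idl) auto
      then have "a \<in> Idl (insert y (Idl A'))" using a by simp
      then obtain c a0 where c: "c \<in> carrier R" "a0 \<in> Idl A'" "a = c \<otimes> y \<oplus> a0"
        using mem_Idl_insert[OF A'.is_ideal yc] by blast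
      have carr': "a0 \<in> carrier R" "a \<in> carrier R" using c yc A'.Icarr by auto
      have sub: "Idl A' \<subseteq> Idl (A' \<union> B)" "Idl B \<subseteq> Idl (A' \<union> B)"
        using A'c carr by (intro subset_Idl_subset; blast)+
      have "c \<otimes> y = a \<ominus> a0" using c(1,3) carr' yc by algebra
      then have "c \<otimes> y \<in> Idl (A' \<union> B)" using AB.minus_closed sub a c(2) by auto
      then have "c \<in> Idl (A' \<union> B)" using AB.I_prime c(1) yc ynot by blast
      then obtain b z where bz: "b \<in> Idl A'" "z \<in> Idl B" "c = b \<oplus> z"
        unfolding sum set_add_def' by blast
      have carr'': "b \<in> carrier R" "z \<in> carrier R" using bz A'.Icarr B.Icarr by auto
      have zy: "z \<otimes> y \<in> Idl B" "z \<otimes> y \<in> I" using bz insert yc yB B.I_r_closed by auto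
      have "a \<ominus> z \<otimes> y = a0 \<oplus> b \<otimes> y" unfolding c(3) bz(3) using carr' carr'' yc by algebra
      moreover have "a \<ominus> z \<otimes> y \<in> Idl B" using B.minus_closed a zy by blast
      moreover have "a0 \<oplus> b \<otimes> y \<in> Idl A'" using c bz yc A'.I_r_closed by auto
      ultimately have "a \<ominus> z \<otimes> y \<in> I" using insert.IH by auto
      then have "(a \<ominus> z \<otimes> y) \<oplus> z \<otimes> y \<in> I" using zy by blast
      moreover have "(a \<ominus> z \<otimes> y) \<oplus> z \<otimes> y = a" using carr' carr'' yc by algebra
      ultimately show "a \<in> I" by simp
    qed
  qed
qed

end

text \<open>Let \<open>N\<close> be generated by the parameters other than \<open>a\<close>. Then \<open>\<mm> = \<langle>a\<rangle> + N\<close>, and so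
\<open>\<mm>\<^sup>2 \<subseteq> \<mm> a + N\<close>. From \<open>a \<in> \<mm>\<^sup>2\<close> one gets \<open>(1 - m) a \<in> N\<close> with \<open>m \<in> \<mm>\<close>, hence \<open>a \<in> N\<close>; but the parameters other
than \<open>a\<close> do not generate \<open>a\<close>.\<close>

lemma (in local_ring) regular_modulo_notin_square:
  assumes reg: "regular_modulo (Idl {}) G" and a: "a \<in> G"
  shows "a \<notin> ideal_pow R (max_ideal R) 2"
proof
  assume sq: "a \<in> ideal_pow R (max_ideal R) 2"
  let ?M = "max_ideal R"
  have Gc: "G \<subseteq> carrier R" and MG: "?M = Idl G"
  proof -
    have G: "G \<subseteq> carrier R" "?M = Idl (Idl {} \<union> G)" using reg unfolding regular_modulo_def by auto
    show "G \<subseteq> carrier R" by (rule G)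
    show "?M = Idl G" using G(2) Idl_union_Idl[OF G(1), of "{}"] by (simp add: Un_commute)
  qed
  have ac: "a \<in> carrier R" using a Gc by blast
  define N where "N = Idl (G - {a})"
  interpret N: ideal N R unfolding N_def by (rule genideal_ideal) (use Gc in blast)
  have "G - (G - {a}) = insert a {}" using a by blast
  then have "regular_modulo N {a}"
    using regular_modulo_Idl_subset[OF reg, of "G - {a}"] unfolding N_def by simp
  then have aN: "a \<notin> N" using regular_modulo_notin[of N a "{}"] by simp
  have "Idl ({a} \<union> Idl (G - {a})) = Idl ({a} \<union> (G - {a}))"
    using Gc ac by (intro Idl_union_Idl) auto
  moreover have "{a} \<union> (G - {a}) = G" using a by blast
  ultimately have MN: "?M = Idl (insert a N)" using MG unfolding N_def by simp
  have NM: "N \<subseteq> ?M" unfolding N_def MG using Gc by (intro subset_Idl_subset) auto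
  define K where "K = {m \<otimes> a \<oplus> n | m n. m \<in> ?M \<and> n \<in> N}"
  have K: "ideal K R"
  proof (rule cring_idealI)
    show "K \<subseteq> carrier R" unfolding K_def using ac M.Icarr N.Icarr by blast
    have "\<zero> = \<zero> \<otimes> a \<oplus> \<zero>" using ac by simp
    then show "\<zero> \<in> K" unfolding K_def using M.zero_closed N.zero_closed by blast
  next
    fix u v assume "u \<in> K" "v \<in> K"
    then obtain m n m' n' where *: "m \<in> ?M" "n \<in> N" "m' \<in> ?M" "n' \<in> N"
      "u = m \<otimes> a \<oplus> n" "v = m' \<otimes> a \<oplus> n'" unfolding K_def by blast
    have "m \<in> carrier R" "m' \<in> carrier R" "n \<in> carrier R" "n' \<in> carrier R"
      using * M.Icarr N.Icarr by auto
    then have "u \<oplus> v = (m \<oplus> m') \<otimes> a \<oplus> (n \<oplus> n')" unfolding *(5,6) using ac by algebra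
    then show "u \<oplus> v \<in> K" unfolding K_def using * M.a_closed N.a_closed by blast
  next
    fix u x assume u: "u \<in> K" and x: "x \<in> carrier R"
    then obtain m n where *: "m \<in> ?M" "n \<in> N" "u = m \<otimes> a \<oplus> n" unfolding K_def by blast
    have "m \<in> carrier R" "n \<in> carrier R" using * M.Icarr N.Icarr by auto
    then have "x \<otimes> u = (x \<otimes> m) \<otimes> a \<oplus> x \<otimes> n" unfolding *(3) using ac x by algebra
    then show "x \<otimes> u \<in> K" unfolding K_def using * x M.I_l_closed N.I_l_closed by blast
  qed
  have "carrier R \<cdot> ?M \<subseteq> ?M" by (rule ideal_prod_subset[OF M.is_ideal M.I_l_closed])
  moreover have "u \<otimes> v \<in> K" if "u \<in> ?M" "v \<in> ?M" for u v
  proof -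
    have "v \<in> Idl (insert a N)" using that(2) MN by simp
    then obtain c n where c: "c \<in> carrier R" "n \<in> N" "v = c \<otimes> a \<oplus> n"
      unfolding mem_Idl_insert[OF N.is_ideal ac] by blast
    have uc: "u \<in> carrier R" "n \<in> carrier R" using that M.Icarr c N.Icarr by auto
    have "u \<otimes> v = (u \<otimes> c) \<otimes> a \<oplus> u \<otimes> n" unfolding c(3) using uc c(1) ac by algebra
    moreover have "u \<otimes> c \<in> ?M" using that c(1) M.I_r_closed by blast
    moreover have "u \<otimes> n \<in> N" using uc c(2) N.I_l_closed by blast
    ultimately show ?thesis unfolding K_def by blast
  qed
  ultimately have "(carrier R \<cdot> ?M) \<cdot> ?M \<subseteq> K"
    by (intro ideal_prod_subset[OF K]) auto
  then have "a \<in> K" using sq by (auto simp: numeral_2_eq_2)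
  then obtain m n where mn: "m \<in> ?M" "n \<in> N" "a = m \<otimes> a \<oplus> n" unfolding K_def by blast
  have mc: "m \<in> carrier R" "n \<in> carrier R" using mn(1,2) M.Icarr N.Icarr by auto
  have "(\<one> \<ominus> m) \<otimes> a = a \<ominus> m \<otimes> a" using mc ac by algebra
  also have "\<dots> = (m \<otimes> a \<oplus> n) \<ominus> m \<otimes> a" using mn(3) by simp
  also have "\<dots> = n" using mc ac by algebra
  finally have "(\<one> \<ominus> m) \<otimes> a \<in> N" using mn(2) by simp
  moreover have "\<one> \<ominus> m \<notin> ?M"
  proof
    assume "\<one> \<ominus> m \<in> ?M"
    then have "(\<one> \<ominus> m) \<oplus> m \<in> ?M" using mn(1) by blast
    moreover have "(\<one> \<ominus> m) \<oplus> m = \<one>" using mc by algebra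
    ultimately show False using M.one_notin by simp
  qed
  ultimately have "a \<in> saturation ?M N" unfolding saturation_def using ac mc by blast
  then show False using saturation_max_ideal[OF N.is_ideal] aN by simp
qed

section \<open>Gorenstein Artin local rings as quotients\<close>

text \<open>The image of \<open>d\<close> is nonzero and generates the socle of \<open>R / J\<close>, expressed in \<open>R\<close>.\<close>

definition (in local_ring) socle_generator :: "'a set \<Rightarrow> 'a \<Rightarrow> bool" where
  "socle_generator J d \<longleftrightarrow> d \<in> carrier R \<and> d \<notin> J \<and>
     (\<forall>x \<in> carrier R. (\<forall>a \<in> max_ideal R. a \<otimes> x \<in> J) \<longleftrightarrow> x \<in> Idl (insert d J))"

text \<open>For the Noetherian ring \<open>R\<close> this says that \<open>R / J\<close> is nonzero and Artinian.\<close>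

definition (in local_ring) maximal_primary :: "'a set \<Rightarrow> bool" where
  "maximal_primary J \<longleftrightarrow> ideal J R \<and> J \<subseteq> max_ideal R \<and>
     (\<forall>P. primeideal P R \<longrightarrow> J \<subseteq> P \<longrightarrow> P = max_ideal R)"

text \<open>Both the given ring \<open>Q\<close>, known up to isomorphism only, and the concrete quotients \<open>T / J\<close> are images
of \<open>T\<close>. Surjections treat the two cases at once.\<close>

locale local_ring_surjection = T: local_ring T + S: ring S
  for T (structure) and S (structure) and h +
  assumes hom: "h \<in> ring_hom T S"
    and surj: "h ` carrier T = carrier S"
    and nontrivial: "\<one>\<^bsub>S\<^esub> \<noteq> \<zero>\<^bsub>S\<^esub>"
begin

sublocale H: ring_hom_ring T S h
  by (intro ring_hom_ringI2 T.ring_axioms S.ring_axioms hom)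

abbreviation ker :: "'a set" where "ker \<equiv> a_kernel T S h"

lemma mem_ker: "x \<in> ker \<longleftrightarrow> x \<in> carrier T \<and> h x = \<zero>\<^bsub>S\<^esub>"
  unfolding a_kernel_def' by blast

lemma ker_ideal: "ideal ker T"
  by (rule H.kernel_is_ideal)

lemma ker_subset_max_ideal: "ker \<subseteq> max_ideal T"
  by (rule T.proper_ideal_subset_max_ideal[OF ker_ideal]) (use nontrivial in \<open>simp add: mem_ker\<close>)

lemma lift: assumes "y \<in> carrier S" obtains x where "x \<in> carrier T" "y = h x"
  using assms surj by blast

lemma S_cring: "cring S"
proof (rule cring.intro[OF S.ring_axioms])
  show "comm_monoid S"
  proof (rule S.monoid_comm_monoidI)
    fix x y assume "x \<in> carrier S" "y \<in> carrier S"
    then obtain a b where "a \<in> carrier T" "b \<in> carrier T" "x = h a" "y = h b"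
      using lift by metis
    then show "x \<otimes>\<^bsub>S\<^esub> y = y \<otimes>\<^bsub>S\<^esub> x"
      by (simp add: T.m_comm flip: H.hom_mult)
  qed
qed

lemma vimage_ideal: "ideal N S \<Longrightarrow> ideal {x \<in> carrier T. h x \<in> N} T"
  by (rule H.ideal_vimage)

lemma image_vimage: "N \<subseteq> carrier S \<Longrightarrow> h ` {x \<in> carrier T. h x \<in> N} = N"
  unfolding surj[symmetric] by blast

lemma ker_subset_vimage: "ideal N S \<Longrightarrow> ker \<subseteq> {x \<in> carrier T. h x \<in> N}"
  using additive_subgroup.zero_closed[OF ideal.axioms(1)] by (auto simp: mem_ker)

lemma h_eq_iff:
  assumes "x \<in> carrier T" "y \<in> carrier T"
  shows "h x = h y \<longleftrightarrow> x \<ominus> y \<in> ker"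
  using assms S.r_right_minus_eq[of "h x" "h y"] by (simp add: mem_ker a_minus_def)

lemma image_ideal:
  assumes N: "ideal N T"
  shows "ideal (h ` N) S"
proof -
  interpret S: cring S by (rule S_cring)
  interpret N: ideal N T by (rule N)
  show ?thesis
  proof (rule S.cring_idealI)
    show "h ` N \<subseteq> carrier S" using N.Icarr by auto
    show "\<zero>\<^bsub>S\<^esub> \<in> h ` N" using H.hom_zero N.zero_closed by (metis imageI)
  next
    fix a b assume "a \<in> h ` N" "b \<in> h ` N"
    then obtain x y where "x \<in> N" "y \<in> N" "a = h x" "b = h y" by blast
    moreover from this have "a \<oplus>\<^bsub>S\<^esub> b = h (x \<oplus> y)" using N.Icarr by simp
    ultimately show "a \<oplus>\<^bsub>S\<^esub> b \<in> h ` N" by blast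
  next
    fix a b assume a: "a \<in> h ` N" and b: "b \<in> carrier S"
    obtain x where x: "x \<in> N" "a = h x" using a by blast
    obtain y where "y \<in> carrier T" "b = h y" using lift[OF b] .
    note xy = x this
    have "b \<otimes>\<^bsub>S\<^esub> a = h (y \<otimes> x)" using N.Icarr xy by simp
    then show "b \<otimes>\<^bsub>S\<^esub> a \<in> h ` N" using N.I_l_closed xy by blast
  qed
qed

lemma S_noetherian: "noetherian_ring S"
proof (rule S.noetherian_ringI)
  fix N assume N: "ideal N S"
  obtain A where A: "A \<subseteq> carrier T" "finite A" "{x \<in> carrier T. h x \<in> N} = Idl A"
    using T.finetely_gen[OF vimage_ideal[OF N]] by blast
  have hA: "h ` A \<subseteq> carrier S" using A(1) by auto
  have "h ` A \<subseteq> N" using A T.genideal_self by blast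
  then have "Idl\<^bsub>S\<^esub> (h ` A) \<subseteq> N" by (rule S.genideal_minimal[OF N])
  moreover have "N \<subseteq> Idl\<^bsub>S\<^esub> (h ` A)"
  proof -
    have "ideal {x \<in> carrier T. h x \<in> Idl\<^bsub>S\<^esub> (h ` A)} T"
      by (rule vimage_ideal[OF S.genideal_ideal[OF hA]])
    then have "Idl A \<subseteq> {x \<in> carrier T. h x \<in> Idl\<^bsub>S\<^esub> (h ` A)}"
      by (rule T.genideal_minimal) (use A S.genideal_self[OF hA] in auto)
    then have "h ` (Idl A) \<subseteq> Idl\<^bsub>S\<^esub> (h ` A)" unfolding image_subset_iff by auto
    then show ?thesis using A(3) image_vimage[OF ideal_subset_carrier[OF N]] by simp
  qed
  ultimately show "\<exists>A\<subseteq>carrier S. finite A \<and> N = Idl\<^bsub>S\<^esub> A" using A(2) hA by blast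
qed

lemma one_notin_image_max_ideal: "\<one>\<^bsub>S\<^esub> \<notin> h ` max_ideal T"
proof
  assume "\<one>\<^bsub>S\<^esub> \<in> h ` max_ideal T"
  then obtain m where m: "m \<in> max_ideal T" "h m = h \<one>" by auto
  have mc: "m \<in> carrier T" using m T.M.Icarr by blast
  then have "\<one> \<ominus> m \<in> max_ideal T"
    using h_eq_iff[of \<one> m] m ker_subset_max_ideal by auto
  then have "(\<one> \<ominus> m) \<oplus> m \<in> max_ideal T" using m by blast
  moreover have "(\<one> \<ominus> m) \<oplus> m = \<one>" using mc by algebra
  ultimately show False using T.M.one_notin by simp
qed

lemma proper_ideal_subset_image_max_ideal:
  assumes N: "ideal N S" "\<one>\<^bsub>S\<^esub> \<notin> N"
  shows "N \<subseteq> h ` max_ideal T"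
proof -
  have "{x \<in> carrier T. h x \<in> N} \<subseteq> max_ideal T"
    by (rule T.proper_ideal_subset_max_ideal[OF vimage_ideal[OF N(1)]]) (use N(2) in simp)
  then have "h ` {x \<in> carrier T. h x \<in> N} \<subseteq> h ` max_ideal T" by (rule image_mono)
  then show ?thesis using image_vimage[OF ideal_subset_carrier[OF N(1)]] by simp
qed

lemma maximalideal_iff: "maximalideal N S \<longleftrightarrow> N = h ` max_ideal T"
proof
  assume "maximalideal N S"
  then interpret N: maximalideal N S .
  have "\<one>\<^bsub>S\<^esub> \<notin> N" using N.I_notcarr N.one_imp_carrier by blast
  then have "N \<subseteq> h ` max_ideal T" by (rule proper_ideal_subset_image_max_ideal[OF N.is_ideal])
  moreover have "h ` max_ideal T \<noteq> carrier S" using one_notin_image_max_ideal by blast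
  moreover have "ideal (h ` max_ideal T) S" by (rule image_ideal[OF T.M.is_ideal])
  ultimately show "N = h ` max_ideal T"
    using N.I_maximal ideal_subset_carrier[of "h ` max_ideal T" S] by blast
next
  assume N: "N = h ` max_ideal T"
  show "maximalideal N S"
  proof (rule maximalidealI)
    show "ideal N S" unfolding N by (rule image_ideal[OF T.M.is_ideal])
    show "carrier S \<noteq> N" unfolding N using one_notin_image_max_ideal by blast
    fix L assume L: "ideal L S" "N \<subseteq> L" "L \<subseteq> carrier S"
    show "L = N \<or> L = carrier S"
      using proper_ideal_subset_image_max_ideal[OF L(1)] ideal.one_imp_carrier[OF L(1)] L(2)
      unfolding N by blast
  qed
qed

lemma S_local: "local_ring S"
  by (intro local_ring.intro local_ring_axioms.intro S_cring S_noetherian)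
    (simp add: maximalideal_iff)

lemma max_ideal_S: "max_ideal S = h ` max_ideal T"
  using local_ring.max_ideal_maximalideal[OF S_local] maximalideal_iff by blast

lemma mem_soc_iff:
  assumes "x \<in> carrier T"
  shows "h x \<in> soc S \<longleftrightarrow> (\<forall>a \<in> max_ideal T. a \<otimes> x \<in> ker)"
proof -
  have "h a \<otimes>\<^bsub>S\<^esub> h x = \<zero>\<^bsub>S\<^esub> \<longleftrightarrow> a \<otimes> x \<in> ker" if "a \<in> max_ideal T" for a
    using that assms T.M.Icarr by (simp add: mem_ker)
  then show ?thesis using assms unfolding soc_def max_ideal_S by simp
qed

lemma h_mem_PIdl_iff:
  assumes "d \<in> carrier T" "x \<in> carrier T"
  shows "h x \<in> PIdl\<^bsub>S\<^esub> (h d) \<longleftrightarrow> x \<in> Idl (insert d ker)"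
proof
  assume "h x \<in> PIdl\<^bsub>S\<^esub> (h d)"
  then obtain c where "c \<in> carrier T" "h x = h c \<otimes>\<^bsub>S\<^esub> h d"
    unfolding cgenideal_def surj[symmetric] by blast
  then have c: "c \<in> carrier T" "x \<ominus> c \<otimes> d \<in> ker"
    using assms h_eq_iff[of x "c \<otimes> d"] by simp_all
  moreover have "x = c \<otimes> d \<oplus> (x \<ominus> c \<otimes> d)" using assms c(1) by algebra
  ultimately show "x \<in> Idl (insert d ker)" unfolding T.mem_Idl_insert[OF ker_ideal assms(1)] by blast
next
  assume "x \<in> Idl (insert d ker)"
  then obtain c b where "c \<in> carrier T" "b \<in> ker" "x = c \<otimes> d \<oplus> b"
    unfolding T.mem_Idl_insert[OF ker_ideal assms(1)] by blast
  then have "h x = h c \<otimes>\<^bsub>S\<^esub> h d" "h c \<in> carrier S" using assms by (auto simp: mem_ker)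
  then show "h x \<in> PIdl\<^bsub>S\<^esub> (h d)" unfolding cgenideal_def by blast
qed

lemma soc_eq_PIdl_iff:
  assumes "d \<in> carrier T"
  shows "(h d \<noteq> \<zero>\<^bsub>S\<^esub> \<and> soc S = PIdl\<^bsub>S\<^esub> (h d)) \<longleftrightarrow> T.socle_generator ker d"
proof -
  interpret S: cring S by (rule S_cring)
  have "soc S \<subseteq> carrier S" unfolding soc_def by blast
  moreover have "PIdl\<^bsub>S\<^esub> (h d) \<subseteq> carrier S" using assms unfolding cgenideal_def by auto
  ultimately have "soc S = PIdl\<^bsub>S\<^esub> (h d) \<longleftrightarrow>
      (\<forall>y \<in> carrier S. y \<in> soc S \<longleftrightarrow> y \<in> PIdl\<^bsub>S\<^esub> (h d))"
    by blast
  also have "\<dots> \<longleftrightarrow> (\<forall>x \<in> carrier T. h x \<in> soc S \<longleftrightarrow> h x \<in> PIdl\<^bsub>S\<^esub> (h d))"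
    unfolding surj[symmetric] by simp
  finally show ?thesis
    using assms mem_soc_iff h_mem_PIdl_iff unfolding T.socle_generator_def
    by (simp add: mem_ker)
qed

text \<open>Ideals are saturated at the maximal ideal, so that \<open>saturated_chain_stabilises\<close> applies to the
preimages of the members of a chain.\<close>

lemma artinian_if_maximal_primary:
  assumes prim: "T.maximal_primary ker"
  shows "artinian_ring S"
  unfolding artinian_ring_def
proof (intro conjI allI impI)
  show "ring S" by (rule S.ring_axioms)
  fix N :: "nat \<Rightarrow> _" assume N: "\<forall>n. ideal (N n) S \<and> N (Suc n) \<subseteq> N n"
  define N' where "N' n = {x \<in> carrier T. h x \<in> N n}" for n
  have N': "ideal (N' n) T" for n unfolding N'_def using N vimage_ideal by blast
  have "\<exists>k. \<forall>n\<ge>k. N' n = N' k"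
  proof (rule T.saturated_chain_stabilises[OF T.max_ideal_primeideal ker_ideal ker_subset_max_ideal])
    show "P = max_ideal T" if "primeideal P T" "ker \<subseteq> P" for P
      using prim that unfolding T.maximal_primary_def by blast
    show "ideal (N' n) T" for n by (rule N')
    show "ker \<subseteq> N' n" for n unfolding N'_def using N ker_subset_vimage by blast
    show "N' (Suc n) \<subseteq> N' n" for n unfolding N'_def using N by blast
    show "T.saturation (max_ideal T) (N' n) \<subseteq> N' n" for n
      using T.saturation_max_ideal[OF N'] by blast
  qed
  moreover have "N n = h ` N' n" for n
    unfolding N'_def using image_vimage[OF ideal_subset_carrier] N by blast
  ultimately show "\<exists>k. \<forall>n\<ge>k. N n = N k" by metis
qed

text \<open>For \<open>a \<in> \<mm>\<close> the chain of the ideals \<open>\<langle>a\<^sup>n\<rangle>\<close> stabilises in \<open>S\<close>, say \<open>a\<^sup>k = c a\<^sup>k\<^sup>+\<^sup>1\<close>; as \<open>1 - c a\<close> is a unit,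
\<open>a\<close> is nilpotent in \<open>S\<close> and belongs to every prime over the kernel.\<close>

lemma maximal_primary_if_artinian:
  assumes "artinian_ring S"
  shows "T.maximal_primary ker"
  unfolding T.maximal_primary_def
proof (intro conjI allI impI ker_ideal ker_subset_max_ideal)
  interpret S: cring S by (rule S_cring)
  fix P assume "primeideal P T" and kerP: "ker \<subseteq> P"
  then interpret P: primeideal P T by blast
  have PM: "P \<subseteq> max_ideal T" by (rule T.proper_ideal_subset_max_ideal[OF P.is_ideal P.one_notin])
  have "a \<in> P" if a: "a \<in> max_ideal T" for a
  proof -
    have ac: "a \<in> carrier T" using a T.M.Icarr by blast
    define N where "N n = PIdl\<^bsub>S\<^esub> (h (a [^] n))" for n :: nat
    have "ideal (N n) S" for n unfolding N_def using ac by (intro S.cgenideal_ideal) simp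
    moreover have "N (Suc n) \<subseteq> N n" for n
      unfolding N_def
    proof (rule S.cgenideal_minimal)
      show I: "ideal (PIdl\<^bsub>S\<^esub> (h (a [^] n))) S" using ac by (intro S.cgenideal_ideal) simp
      show "h (a [^] Suc n) \<in> PIdl\<^bsub>S\<^esub> (h (a [^] n))"
        using ideal.I_r_closed[OF I S.cgenideal_self, of "h a"] ac by simp
    qed
    ultimately obtain k where "N (Suc k) = N k"
      using assms unfolding artinian_ring_def by (meson le_Suc_eq order_refl)
    then have "h (a [^] k) \<in> N (Suc k)" unfolding N_def using S.cgenideal_self ac by simp
    then have "a [^] k \<in> Idl (insert (a [^] Suc k) ker)"
      unfolding N_def using h_mem_PIdl_iff[OF T.nat_pow_closed T.nat_pow_closed, OF ac ac] by blast
    then obtain c b where c: "c \<in> carrier T" "b \<in> ker" "a [^] k = c \<otimes> a [^] Suc k \<oplus> b"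
      unfolding T.mem_Idl_insert[OF ker_ideal T.nat_pow_closed[OF ac]] by blast
    have bc: "b \<in> carrier T" using c(2) by (simp add: mem_ker)
    have pc: "a [^] k \<in> carrier T" using ac by simp
    have "(\<one> \<ominus> c \<otimes> a) \<otimes> a [^] k = a [^] k \<ominus> c \<otimes> (a [^] k \<otimes> a)" using c(1) ac pc by algebra
    also have "\<dots> = c \<otimes> (a [^] k \<otimes> a) \<oplus> b \<ominus> c \<otimes> (a [^] k \<otimes> a)" using c(3) by simp
    also have "\<dots> = b" using c(1) ac pc bc by algebra
    finally have "(\<one> \<ominus> c \<otimes> a) \<otimes> a [^] k \<in> P" using c(2) kerP by auto
    moreover have "\<one> \<ominus> c \<otimes> a \<notin> P"
    proof
      assume "\<one> \<ominus> c \<otimes> a \<in> P"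
      then have "(\<one> \<ominus> c \<otimes> a) \<oplus> c \<otimes> a \<in> max_ideal T"
        using PM a c(1) T.M.I_l_closed by blast
      moreover have "(\<one> \<ominus> c \<otimes> a) \<oplus> c \<otimes> a = \<one>" using c(1) ac by algebra
      ultimately show False using T.M.one_notin by simp
    qed
    moreover have "\<one> \<ominus> c \<otimes> a \<in> carrier T" using c(1) ac by simp
    ultimately have "a [^] k \<in> P" using P.I_prime pc by blast
    moreover have "a [^] n \<notin> P" if "a \<notin> P" for n :: nat
    proof (induction n)
      case 0
      then show ?case using P.one_notin by simp
    next
      case (Suc n)
      then show ?case using P.mult_notin[of "a [^] n" a] ac that by simp
    qed
    ultimately show ?thesis by blast
  qed
  then show "P = max_ideal T" using PM by blast
qed

theorem gorenstein_artin_local_iff: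
  "gorenstein_artin_local S \<longleftrightarrow> T.maximal_primary ker \<and> (\<exists>d. T.socle_generator ker d)"
proof -
  have "(\<exists>\<delta>\<in>carrier S. \<delta> \<noteq> \<zero>\<^bsub>S\<^esub> \<and> soc S = PIdl\<^bsub>S\<^esub> \<delta>) \<longleftrightarrow>
      (\<exists>d \<in> carrier T. T.socle_generator ker d)"
    unfolding surj[symmetric] using soc_eq_PIdl_iff by auto
  also have "\<dots> \<longleftrightarrow> (\<exists>d. T.socle_generator ker d)" unfolding T.socle_generator_def by blast
  finally show ?thesis
    unfolding gorenstein_artin_local_def
    using S_local artinian_if_maximal_primary maximal_primary_if_artinian by blast
qed

end

lemma (in local_ring) quotient_surjection:
  assumes J: "ideal J R" "J \<subseteq> max_ideal R"
  shows "local_ring_surjection R (R Quot J) ((+>) J)" "a_kernel R (R Quot J) ((+>) J) = J"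
proof -
  interpret J: ideal J R by (rule J(1))
  interpret Q: ring "R Quot J" by (rule J.quotient_is_ring)
  have z: "\<zero>\<^bsub>R Quot J\<^esub> = J" "\<one>\<^bsub>R Quot J\<^esub> = J +> \<one>" by (simp_all add: FactRing_def)
  have mem: "J +> x = J \<longleftrightarrow> x \<in> J" if "x \<in> carrier R" for x
    using that J.rcos_const_imp_mem a_rcos_zero[OF J(1)] by blast
  show "a_kernel R (R Quot J) ((+>) J) = J"
    unfolding a_kernel_def' z using mem J.Icarr by blast
  show "local_ring_surjection R (R Quot J) ((+>) J)"
  proof (unfold_locales)
    show "(+>) J \<in> ring_hom R (R Quot J)" by (rule J.rcos_ring_hom)
    show "(+>) J ` carrier R = carrier (R Quot J)"
      unfolding FactRing_simps by auto
    show "\<one>\<^bsub>R Quot J\<^esub> \<noteq> \<zero>\<^bsub>R Quot J\<^esub>" unfolding z using mem J(2) M.one_notin by auto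
  qed
qed

lemma (in local_ring) iso_quotient_surjection:
  assumes J: "ideal J R" "J \<subseteq> max_ideal R" and iso: "R Quot J \<simeq> Q" and Q: "ring Q"
  obtains h where "local_ring_surjection R Q h" "a_kernel R Q h = J"
proof -
  interpret p: local_ring_surjection R "R Quot J" "(+>) J" by (rule quotient_surjection[OF J])
  interpret Q: ring Q by (rule Q)
  obtain g where g: "g \<in> ring_iso (R Quot J) Q" using iso unfolding is_ring_iso_def by blast
  then have gh: "g \<in> ring_hom (R Quot J) Q" and gb: "bij_betw g (carrier (R Quot J)) (carrier Q)"
    unfolding ring_iso_def by auto
  interpret g: ring_hom_ring "R Quot J" Q g
    by (intro ring_hom_ringI2 p.S.ring_axioms Q gh)
  have g0: "g y = \<zero>\<^bsub>Q\<^esub> \<longleftrightarrow> y = \<zero>\<^bsub>R Quot J\<^esub>" if "y \<in> carrier (R Quot J)" for y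
    using gb that g.hom_zero p.S.zero_closed unfolding bij_betw_def inj_on_def by metis
  have "g \<circ> (+>) J \<in> ring_hom R Q" by (rule ring_hom_trans[OF p.hom gh])
  moreover have "(g \<circ> (+>) J) ` carrier R = carrier Q"
    using gb p.surj unfolding bij_betw_def by (metis image_comp)
  moreover have "\<one>\<^bsub>Q\<^esub> \<noteq> \<zero>\<^bsub>Q\<^esub>" using g0[OF p.S.one_closed] p.nontrivial g.hom_one by simp
  ultimately have "local_ring_surjection R Q (g \<circ> (+>) J)" by unfold_locales
  moreover have "a_kernel R Q (g \<circ> (+>) J) = J"
  proof -
    have "(g \<circ> (+>) J) x = \<zero>\<^bsub>Q\<^esub> \<longleftrightarrow> J +> x = \<zero>\<^bsub>R Quot J\<^esub>" if "x \<in> carrier R" for x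
      using g0[OF p.H.hom_closed[OF that]] by (simp only: o_apply)
    then have "a_kernel R Q (g \<circ> (+>) J) = p.ker"
      unfolding a_kernel_def' by (intro Collect_cong conj_cong refl)
    then show ?thesis using quotient_surjection(2)[OF J] by simp
  qed
  ultimately show thesis by (rule that)
qed

section \<open>Fibre products of two quotients\<close>

context local_ring
begin

lemma residue_proj_coset:
  assumes J: "ideal J R" "J \<subseteq> max_ideal R" and x: "x \<in> carrier R"
  shows "residue_proj R (J +> x) = max_ideal R +> x"
proof
  interpret J: ideal J R by (rule J(1))
  show "residue_proj R (J +> x) \<subseteq> max_ideal R +> x"
  proof
    fix y assume "y \<in> residue_proj R (J +> x)"
    then obtain m j where mj: "m \<in> max_ideal R" "j \<in> J" "y = m \<oplus> (j \<oplus> x)"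
      unfolding residue_proj_def set_add_def' a_r_coset_def' by blast
    have "m \<oplus> (j \<oplus> x) = (m \<oplus> j) \<oplus> x"
      using mj(1,2) x M.Icarr J.Icarr by (simp add: a_assoc)
    moreover have "m \<oplus> j \<in> max_ideal R" using mj(1,2) J(2) by (intro M.a_closed) auto
    ultimately show "y \<in> max_ideal R +> x" unfolding a_r_coset_def' mj(3) by blast
  qed
  show "max_ideal R +> x \<subseteq> residue_proj R (J +> x)"
  proof
    fix y assume "y \<in> max_ideal R +> x"
    then obtain m where m: "m \<in> max_ideal R" "y = m \<oplus> (\<zero> \<oplus> x)"
      using x unfolding a_r_coset_def' by auto
    then show "y \<in> residue_proj R (J +> x)"
      unfolding residue_proj_def set_add_def' a_r_coset_def' using J.zero_closed by blast
  qed
qed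

lemma residue_proj_hom:
  assumes J: "ideal J R" "J \<subseteq> max_ideal R"
  shows "residue_proj R \<in> ring_hom (R Quot J) (R Quot max_ideal R)"
    and "residue_proj R ` carrier (R Quot J) = carrier (R Quot max_ideal R)"
proof -
  interpret p: local_ring_surjection R "R Quot J" "(+>) J" by (rule quotient_surjection[OF J])
  interpret k: local_ring_surjection R "R Quot max_ideal R" "(+>) (max_ideal R)"
    by (rule quotient_surjection[OF M.is_ideal order_refl])
  note eq = residue_proj_coset[OF J]
  show "residue_proj R ` carrier (R Quot J) = carrier (R Quot max_ideal R)"
    unfolding p.surj[symmetric] k.surj[symmetric] image_image
    by (rule image_cong) (simp_all add: eq)
  show "residue_proj R \<in> ring_hom (R Quot J) (R Quot max_ideal R)"
  proof (rule ring_hom_memI)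
    fix a assume a: "a \<in> carrier (R Quot J)"
    obtain x where x: "x \<in> carrier R" "a = J +> x" using p.lift[OF a] .
    show "residue_proj R a \<in> carrier (R Quot max_ideal R)"
      unfolding x(2) eq[OF x(1)] using x(1) by (rule k.H.hom_closed)
    fix b assume b: "b \<in> carrier (R Quot J)"
    obtain y where y: "y \<in> carrier R" "b = J +> y" using p.lift[OF b] .
    show "residue_proj R (a \<otimes>\<^bsub>R Quot J\<^esub> b) =
        residue_proj R a \<otimes>\<^bsub>R Quot max_ideal R\<^esub> residue_proj R b"
      unfolding x(2) y(2) p.H.hom_mult[OF x(1) y(1), symmetric] eq[OF x(1)] eq[OF y(1)]
        eq[OF m_closed[OF x(1) y(1)]] by (rule k.H.hom_mult[OF x(1) y(1)])
    show "residue_proj R (a \<oplus>\<^bsub>R Quot J\<^esub> b) =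
        residue_proj R a \<oplus>\<^bsub>R Quot max_ideal R\<^esub> residue_proj R b"
      unfolding x(2) y(2) p.H.hom_add[OF x(1) y(1), symmetric] eq[OF x(1)] eq[OF y(1)]
        eq[OF a_closed[OF x(1) y(1)]] by (rule k.H.hom_add[OF x(1) y(1)])
  next
    show "residue_proj R \<one>\<^bsub>R Quot J\<^esub> = \<one>\<^bsub>R Quot max_ideal R\<^esub>"
      unfolding p.H.hom_one[symmetric] eq[OF one_closed] by (rule k.H.hom_one)
  qed
qed

text \<open>If \<open>x\<close> and \<open>y\<close> have the same residue, write \<open>x - y = j + k\<close> with \<open>j \<in> J\<close> and \<open>k \<in> K\<close>; then \<open>x - j = y + k\<close>
represents both \<open>x\<close> modulo \<open>J\<close> and \<open>y\<close> modulo \<open>K\<close>. So \<open>R\<close> maps onto the fibre product.\<close>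

lemma fibre_product_quotients:
  assumes J: "ideal J R" "J \<subseteq> max_ideal R" and K: "ideal K R" "K \<subseteq> max_ideal R"
    and JK: "max_ideal R \<subseteq> J <+> K"
  defines "P \<equiv> fibre_product (R Quot J) (residue_proj R) (R Quot K) (residue_proj R)"
    and "f \<equiv> (\<lambda>t. (J +> t, K +> t))"
  shows "local_ring_surjection R P f" "a_kernel R P f = J \<inter> K"
proof -
  interpret J: ideal J R by (rule J)
  interpret K: ideal K R by (rule K)
  interpret p: local_ring_surjection R "R Quot J" "(+>) J" by (rule quotient_surjection[OF J])
  interpret q: local_ring_surjection R "R Quot K" "(+>) K" by (rule quotient_surjection[OF K])
  define D where "D = RDirProd (R Quot J) (R Quot K)"
  have D: "(a, b) \<otimes>\<^bsub>D\<^esub> (a', b') = (a \<otimes>\<^bsub>R Quot J\<^esub> a', b \<otimes>\<^bsub>R Quot K\<^esub> b')"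
    "(a, b) \<oplus>\<^bsub>D\<^esub> (a', b') = (a \<oplus>\<^bsub>R Quot J\<^esub> a', b \<oplus>\<^bsub>R Quot K\<^esub> b')"
    "\<one>\<^bsub>D\<^esub> = (\<one>\<^bsub>R Quot J\<^esub>, \<one>\<^bsub>R Quot K\<^esub>)" "\<zero>\<^bsub>D\<^esub> = (\<zero>\<^bsub>R Quot J\<^esub>, \<zero>\<^bsub>R Quot K\<^esub>)"
    "carrier D = carrier (R Quot J) \<times> carrier (R Quot K)" for a a' b b'
    unfolding D_def RDirProd_def DirProd_def monoid.defs by simp_all
  have f: "f \<in> ring_hom R D"
    by (rule ring_hom_memI) (simp_all add: f_def D)
  interpret D: ring D unfolding D_def by (rule RDirProd_ring[OF p.S.ring_axioms q.S.ring_axioms])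
  interpret F: ring_hom_ring R D f by (rule ring_hom_ringI2[OF ring_axioms D.ring_axioms f])
  have fib: "(a, b) \<in> f ` carrier R" if a: "a \<in> carrier (R Quot J)" and b: "b \<in> carrier (R Quot K)"
    and ab: "residue_proj R a = residue_proj R b" for a b
  proof -
    obtain x where x: "x \<in> carrier R" "a = J +> x" using p.lift[OF a] .
    obtain y where y: "y \<in> carrier R" "b = K +> y" using q.lift[OF b] .
    have "max_ideal R +> x = max_ideal R +> y"
      using ab unfolding x(2) y(2) residue_proj_coset[OF J x(1)] residue_proj_coset[OF K y(1)] .
    then have "x \<ominus> y \<in> max_ideal R"
      using quotient_eq_iff_same_a_r_cos[OF M.is_ideal x(1) y(1)] by simp
    then have "x \<ominus> y \<in> J <+> K" using JK by auto
    then obtain j k where jk: "j \<in> J" "k \<in> K" "x \<ominus> y = j \<oplus> k" unfolding set_add_def' by blast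
    have c: "j \<in> carrier R" "k \<in> carrier R" using jk J.Icarr K.Icarr by auto
    define t where "t = x \<ominus> j"
    have t: "t \<in> carrier R" unfolding t_def using x(1) c by simp
    have "x \<ominus> t = j" unfolding t_def using x(1) c by algebra
    then have "J +> x = J +> t"
      using quotient_eq_iff_same_a_r_cos[OF J(1) x(1) t] jk(1) by simp
    moreover have "y \<ominus> t = \<ominus> k"
    proof -
      have "y \<ominus> t = j \<ominus> (x \<ominus> y)" unfolding t_def using x(1) y(1) c by algebra
      also have "\<dots> = \<ominus> k" unfolding jk(3) using c by algebra
      finally show ?thesis .
    qed
    then have "K +> y = K +> t"
      using quotient_eq_iff_same_a_r_cos[OF K(1) y(1) t] K.a_inv_closed[OF jk(2)] by simp
    ultimately show ?thesis unfolding f_def x(2) y(2) using t by blast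
  qed
  have "f t \<in> {(r, s). r \<in> carrier (R Quot J) \<and> s \<in> carrier (R Quot K) \<and>
      residue_proj R r = residue_proj R s}" if "t \<in> carrier R" for t
    unfolding f_def using that residue_proj_coset[OF J that] residue_proj_coset[OF K that]
      p.H.hom_closed[OF that] q.H.hom_closed[OF that] by simp
  then have "{(r, s). r \<in> carrier (R Quot J) \<and> s \<in> carrier (R Quot K) \<and>
      residue_proj R r = residue_proj R s} = f ` carrier R"
    using fib by (intro subset_antisym image_subsetI subsetI) force+
  then have P: "P = D\<lparr>carrier := f ` carrier R\<rparr>"
    unfolding P_def fibre_product_def D_def by simp
  interpret P: ring P unfolding P by (rule F.img_is_ring)
  show "local_ring_surjection R P f"
  proof (unfold_locales)
    show "f \<in> ring_hom R P" using f unfolding P ring_hom_def by auto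
    show "f ` carrier R = carrier P" unfolding P by simp
    show "\<one>\<^bsub>P\<^esub> \<noteq> \<zero>\<^bsub>P\<^esub>" unfolding P by (simp add: D p.nontrivial)
  qed
  show "a_kernel R P f = J \<inter> K"
  proof -
    have "f x = \<zero>\<^bsub>P\<^esub> \<longleftrightarrow> x \<in> J \<inter> K" if "x \<in> carrier R" for x
      using p.mem_ker[of x] q.mem_ker[of x] that
      unfolding P f_def quotient_surjection(2)[OF J] quotient_surjection(2)[OF K] by (simp add: D)
    then have "a_kernel R P f = {x \<in> carrier R. x \<in> J \<inter> K}"
      unfolding a_kernel_def' by (intro Collect_cong conj_cong refl)
    then show ?thesis using J.a_subset by blast
  qed
qed

end

section \<open>Changing the generator of the socle\<close>

lemma (in local_ring) socle_generator_mult_mem: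
  assumes "ideal J R" "socle_generator J d" "a \<in> max_ideal R"
  shows "a \<otimes> d \<in> J"
proof -
  have d: "d \<in> carrier R" "\<forall>x \<in> carrier R. x \<in> Idl (insert d J) \<longrightarrow> (\<forall>a \<in> max_ideal R. a \<otimes> x \<in> J)"
    using assms(2) unfolding socle_generator_def by auto
  have "insert d J \<subseteq> carrier R" using d(1) ideal_subset_carrier[OF assms(1)] by blast
  from genideal_self[OF this] show ?thesis using d assms(3) by blast
qed

text \<open>The socle of \<open>R / J\<close> is one-dimensional over the residue field, so a nonzero element of it and the
generator differ by a unit.\<close>

lemma (in local_ring) socle_generator_unit_multiple:
  assumes J: "ideal J R" and d: "socle_generator J d" and g: "g \<in> carrier R" "g \<notin> J"
    and Mg: "\<And>a. a \<in> max_ideal R \<Longrightarrow> a \<otimes> g \<in> J"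
  obtains c where "c \<in> carrier R" "c \<otimes> g \<ominus> d \<in> J"
proof -
  interpret J: ideal J R by (rule J)
  have dc: "d \<in> carrier R" using d unfolding socle_generator_def by blast
  have "g \<in> Idl (insert d J)" using d g(1) Mg unfolding socle_generator_def by blast
  then obtain c b where c: "c \<in> carrier R" "b \<in> J" "g = c \<otimes> d \<oplus> b"
    unfolding mem_Idl_insert[OF J dc] by blast
  have bc: "b \<in> carrier R" using c(2) J.Icarr by blast
  have "c \<notin> max_ideal R"
  proof
    assume "c \<in> max_ideal R"
    then have "c \<otimes> d \<in> J" using socle_generator_mult_mem[OF J d] by blast
    then show False using c g(2) J.a_closed by blast
  qed
  then obtain u where u: "u \<in> carrier R" "u \<otimes> c = \<one>" using unit_of_notin_max_ideal c(1) by blast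
  have "u \<otimes> g \<ominus> d = (u \<otimes> c) \<otimes> d \<oplus> u \<otimes> b \<ominus> d" unfolding c(3) using u(1) c(1) bc dc by algebra
  also have "\<dots> = u \<otimes> b" unfolding u(2) using u(1) bc dc by algebra
  finally show thesis using that u(1) J.I_l_closed[OF c(2) u(1)] by simp
qed

lemma (in local_ring) socle_generatorI:
  assumes J: "ideal J R" and d: "socle_generator J d" and g: "g \<in> carrier R" "g \<notin> J"
    and Mg: "\<And>a. a \<in> max_ideal R \<Longrightarrow> a \<otimes> g \<in> J"
  shows "socle_generator J g"
proof -
  interpret J: ideal J R by (rule J)
  have dc: "d \<in> carrier R" using d unfolding socle_generator_def by blast
  have sub: "insert g J \<subseteq> carrier R" "insert d J \<subseteq> carrier R" using g dc J.a_subset by auto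
  obtain c where c: "c \<in> carrier R" "c \<otimes> g \<ominus> d \<in> J"
    using socle_generator_unit_multiple[OF J d g Mg] by blast
  interpret G: ideal "Idl (insert g J)" R using sub by (intro genideal_ideal)
  interpret D: ideal "Idl (insert d J)" R using sub by (intro genideal_ideal)
  have G: "insert g J \<subseteq> Idl (insert g J)" using sub by (intro genideal_self)
  have D: "insert d J \<subseteq> Idl (insert d J)" using sub by (intro genideal_self)
  have "g \<in> Idl (insert g J)" "c \<otimes> g \<ominus> d \<in> Idl (insert g J)" using G c(2) by blast+
  then have "c \<otimes> g \<ominus> (c \<otimes> g \<ominus> d) \<in> Idl (insert g J)"
    by (rule G.minus_closed[OF G.I_l_closed[OF _ c(1)]])
  moreover have "c \<otimes> g \<ominus> (c \<otimes> g \<ominus> d) = d" using c(1) g(1) dc by algebra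
  ultimately have "Idl (insert d J) \<subseteq> Idl (insert g J)"
    using G by (intro genideal_minimal G.is_ideal) auto
  moreover have "g \<in> Idl (insert d J)" using d g(1) Mg unfolding socle_generator_def by blast
  then have "Idl (insert g J) \<subseteq> Idl (insert d J)"
    using D by (intro genideal_minimal D.is_ideal) auto
  ultimately have "Idl (insert g J) = Idl (insert d J)" by blast
  then show ?thesis using d g unfolding socle_generator_def by simp
qed

section \<open>Parameters split into two orthogonal blocks\<close>

text \<open>The situation of the proposition, with the two blocks of parameters as sets. It is symmetric in \<open>A\<close>
and \<open>B\<close>; statements about the second quotient are those about the first one with \<open>A\<close> and \<open>B\<close>
interchanged.\<close>

locale orthogonal_parameters = local_ring R for R (structure) +
  fixes I A B
  assumes I: "ideal I R"
    and reg: "regular_modulo (Idl {}) (A \<union> B)"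
    and disjoint: "A \<inter> B = {}"
    and nonempty: "A \<noteq> {}" "B \<noteq> {}"
    and I_square: "I \<subseteq> ideal_pow R (max_ideal R) 2"
    and orthogonal: "\<And>a b. a \<in> A \<Longrightarrow> b \<in> B \<Longrightarrow> a \<otimes> b \<in> I"
    and primary: "maximal_primary I"
    and gorenstein: "\<exists>d. socle_generator I d"
begin

lemma carr: "A \<subseteq> carrier R" "B \<subseteq> carrier R"
  using reg unfolding regular_modulo_def by auto

lemma swapped: "orthogonal_parameters R I B A"
proof (intro orthogonal_parameters.intro orthogonal_parameters_axioms.intro local_ring_axioms
    I I_square primary gorenstein nonempty)
  show "regular_modulo (Idl {}) (B \<union> A)" using reg by (simp only: Un_commute)
  show "B \<inter> A = {}" using disjoint by (simp only: Int_commute)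
  fix b a assume ba: "b \<in> B" "a \<in> A"
  then have "b \<otimes> a = a \<otimes> b" using carr by (intro m_comm) auto
  then show "b \<otimes> a \<in> I" using orthogonal[OF ba(2,1)] by simp
qed

sublocale I: ideal I R by (rule I)
sublocale YY: ideal "Idl A" R using carr by (intro genideal_ideal)
sublocale ZZ: ideal "Idl B" R using carr by (intro genideal_ideal)

lemma inter_subset: "Idl A \<inter> Idl B \<subseteq> I"
  by (rule regular_parameters_inter_subset[OF reg disjoint I orthogonal])

lemma mult_mem:
  assumes "y \<in> Idl A" "z \<in> Idl B"
  shows "y \<otimes> z \<in> I"
  using YY.I_r_closed[OF assms(1) ZZ.Icarr[OF assms(2)]]
    ZZ.I_l_closed[OF assms(2) YY.Icarr[OF assms(1)]] inter_subset by auto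

lemma max_ideal_Idl: "max_ideal R = Idl (A \<union> B)"
proof -
  have "Idl (A \<union> B) = Idl ((A \<union> B) \<union> Idl {})"
    using Idl_union_Idl[of "A \<union> B" "{}"] carr by simp
  then show ?thesis using reg unfolding regular_modulo_def by (simp add: Un_commute)
qed

lemma parameter_ideals_subset: "Idl A \<subseteq> max_ideal R" "Idl B \<subseteq> max_ideal R"
  unfolding max_ideal_Idl using carr by (intro subset_Idl_subset; blast)+

lemma mem_max_ideal:
  assumes "x \<in> max_ideal R"
  obtains y z where "y \<in> Idl A" "z \<in> Idl B" "x = y \<oplus> z"
proof -
  have "Idl A <+> Idl B = Idl (Idl A \<union> Idl B)"
    using union_genideal YY.is_ideal ZZ.is_ideal by simp
  also have "\<dots> = Idl (Idl A \<union> B)" using YY.a_subset carr by (intro Idl_union_Idl)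
  also have "\<dots> = Idl (A \<union> B)" using Idl_union_Idl[of B A] carr by (simp add: Un_commute)
  finally have "x \<in> Idl A <+> Idl B" using assms max_ideal_Idl by simp
  then show thesis using that unfolding set_add_def' by blast
qed

text \<open>If \<open>A\<close> and \<open>B\<close> are the blocks \<open>Y\<close> and \<open>Z\<close>, then \<open>J\<close> is \<open>J_R\<close>; if \<open>Z\<close> and \<open>Y\<close>, it is \<open>J_S\<close>.\<close>

definition J :: "'a set" where "J = (I \<inter> Idl A) <+> Idl B"

lemma memJ: "x \<in> J \<longleftrightarrow> (\<exists>i \<in> I \<inter> Idl A. \<exists>z \<in> Idl B. x = i \<oplus> z)"
  unfolding J_def set_add_def' by blast

lemma J_ideal: "ideal J R"
  unfolding J_def by (intro add_ideals i_intersect I YY.is_ideal ZZ.is_ideal)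

sublocale J: ideal J R by (rule J_ideal)

lemma subset_J: "I \<inter> Idl A \<subseteq> J" "Idl B \<subseteq> J"
proof -
  show "Idl B \<subseteq> J"
  proof
    fix z assume "z \<in> Idl B"
    moreover from this have "z = \<zero> \<oplus> z" using ZZ.Icarr by simp
    ultimately show "z \<in> J" unfolding memJ using I.zero_closed YY.zero_closed by blast
  qed
  show "I \<inter> Idl A \<subseteq> J"
  proof
    fix i assume "i \<in> I \<inter> Idl A"
    moreover from this have "i = i \<oplus> \<zero>" using I.Icarr by simp
    ultimately show "i \<in> J" unfolding memJ using ZZ.zero_closed by blast
  qed
qed

lemma J_subset: "J \<subseteq> max_ideal R"
proof
  fix x assume "x \<in> J"
  then obtain i z where "i \<in> I \<inter> Idl A" "z \<in> Idl B" "x = i \<oplus> z" unfolding memJ by blast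
  then show "x \<in> max_ideal R" using parameter_ideals_subset M.a_closed[of i z] by auto
qed

text \<open>If \<open>i + z\<close> with \<open>i \<in> I \<inter> \<langle>A\<rangle>\<close> and \<open>z \<in> \<langle>B\<rangle>\<close> lies in \<open>\<langle>A\<rangle>\<close>, then so does \<open>z\<close>, which is therefore in
\<open>\<langle>A\<rangle> \<inter> \<langle>B\<rangle> \<subseteq> I\<close>.\<close>

lemma J_inter: "J \<inter> Idl A = I \<inter> Idl A"
proof
  show "I \<inter> Idl A \<subseteq> J \<inter> Idl A" using subset_J by blast
  show "J \<inter> Idl A \<subseteq> I \<inter> Idl A"
  proof
    fix x assume x: "x \<in> J \<inter> Idl A"
    then have "x \<in> J" by simp
    then obtain i z where "i \<in> I \<inter> Idl A" "z \<in> Idl B" "x = i \<oplus> z" unfolding memJ by blast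
    then have iz: "i \<in> I" "i \<in> Idl A" "z \<in> Idl B" "x = i \<oplus> z" by simp_all
    have ic: "i \<in> carrier R" "z \<in> carrier R" using iz I.Icarr ZZ.Icarr by auto
    have "z = x \<ominus> i" unfolding iz(4) using ic by algebra
    moreover have "x \<ominus> i \<in> Idl A" using x iz(2) by (intro YY.minus_closed) simp_all
    ultimately have "z \<in> Idl A" by (rule ssubst)
    then have "z \<in> I" using iz inter_subset by blast
    then show "x \<in> I \<inter> Idl A" using x iz I.a_closed[of i z] by simp
  qed
qed

lemma not_subset_I: "\<not> Idl A \<subseteq> I"
proof
  assume "Idl A \<subseteq> I"
  moreover obtain a where a: "a \<in> A" using nonempty by blast
  moreover have "a \<in> Idl A" using genideal_self[OF carr(1)] a by blast
  ultimately have "a \<in> ideal_pow R (max_ideal R) 2" using I_square by blast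
  then show False using regular_modulo_notin_square[OF reg] a by blast
qed

lemma max_ideal_not_subset_J: "\<not> max_ideal R \<subseteq> J"
  using J_inter not_subset_I parameter_ideals_subset by blast

text \<open>The ideal \<open>\<langle>A\<rangle>\<close> is nonzero in the Artinian ring \<open>R / I\<close>. Only the maximal ideal can be associated to
it, so it contains a nonzero element of the socle, and any such element generates the socle.\<close>

lemma ex_socle_generator: "\<exists>d \<in> Idl A. socle_generator I d"
proof -
  obtain d where d: "socle_generator I d" using gorenstein by blast
  obtain g where g: "g \<in> Idl A" "g \<notin> I" "primeideal {a \<in> carrier R. a \<otimes> g \<in> I} R"
    using ex_prime_colon[OF I YY.is_ideal not_subset_I] by blast
  have gc: "g \<in> carrier R" using g YY.Icarr by blast
  have "I \<subseteq> {a \<in> carrier R. a \<otimes> g \<in> I}"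
  proof
    fix i assume "i \<in> I"
    then show "i \<in> {a \<in> carrier R. a \<otimes> g \<in> I}" using I.I_r_closed[OF _ gc] I.Icarr by simp
  qed
  then have "{a \<in> carrier R. a \<otimes> g \<in> I} = max_ideal R"
    using primary g(3) unfolding maximal_primary_def by blast
  then have "a \<otimes> g \<in> I" if "a \<in> max_ideal R" for a using that by blast
  then show ?thesis using socle_generatorI[OF I d gc g(2)] g(1) by blast
qed

text \<open>A prime over \<open>J\<close> contains \<open>I \<inter> \<langle>A\<rangle>\<close>, hence the product \<open>I \<cdot> \<langle>A\<rangle>\<close>, hence \<open>I\<close> or \<open>\<langle>A\<rangle>\<close>. In the first case it is
the maximal ideal by assumption on \<open>I\<close>; in the second case it contains \<open>\<langle>A\<rangle>\<close> and \<open>\<langle>B\<rangle>\<close>.\<close>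

lemma maximal_primary_J: "maximal_primary J"
  unfolding maximal_primary_def
proof (intro conjI allI impI J_ideal J_subset)
  fix P assume P: "primeideal P R" and JP: "J \<subseteq> P"
  interpret P: primeideal P R by (rule P)
  have "Idl A \<subseteq> P"
  proof (rule ccontr)
    assume "\<not> Idl A \<subseteq> P"
    then obtain y where y: "y \<in> Idl A" "y \<notin> P" by blast
    have yc: "y \<in> carrier R" using y YY.Icarr by blast
    have "I \<subseteq> P"
    proof
      fix i assume i: "i \<in> I"
      then have "i \<otimes> y \<in> I \<inter> Idl A"
        using I.I_r_closed[OF i yc] YY.I_l_closed[OF y(1) I.Icarr[OF i]] by blast
      then have "i \<otimes> y \<in> P" using subset_J JP by blast
      then show "i \<in> P" using P.I_prime I.Icarr[OF i] yc y by blast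
    qed
    then have "P = max_ideal R" using primary P unfolding maximal_primary_def by blast
    then show False using y parameter_ideals_subset by blast
  qed
  moreover have "Idl B \<subseteq> P" using subset_J JP by blast
  ultimately have "max_ideal R \<subseteq> P"
    unfolding max_ideal_Idl using carr genideal_self[of A] genideal_self[of B]
    by (intro genideal_minimal P.is_ideal) blast
  moreover have "P \<subseteq> max_ideal R"
    by (rule proper_ideal_subset_max_ideal[OF P.is_ideal P.one_notin])
  ultimately show "P = max_ideal R" by blast
qed

text \<open>An element \<open>x\<close> of the maximal ideal that lies in the socle modulo \<open>J\<close> is congruent modulo \<open>\<langle>B\<rangle> \<subseteq> J\<close> to
some \<open>y \<in> \<langle>A\<rangle>\<close>. Then \<open>\<mm> y \<subseteq> J \<inter> \<langle>A\<rangle> \<subseteq> I\<close>, so \<open>y\<close> lies in the socle modulo \<open>I\<close>, which \<open>d\<close> generates.\<close>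

lemma socle_generator_J:
  assumes d: "socle_generator I d" and dA: "d \<in> Idl A"
  shows "socle_generator J d"
  unfolding socle_generator_def
proof (intro conjI ballI)
  show dc: "d \<in> carrier R" using dA YY.Icarr by blast
  have "d \<notin> I" using d unfolding socle_generator_def by blast
  then show "d \<notin> J" using J_inter dA by blast
  fix x assume x: "x \<in> carrier R"
  show "(\<forall>a\<in>max_ideal R. a \<otimes> x \<in> J) \<longleftrightarrow> x \<in> Idl (insert d J)"
  proof
    assume "x \<in> Idl (insert d J)"
    then obtain c b where c: "c \<in> carrier R" "b \<in> J" "x = c \<otimes> d \<oplus> b"
      unfolding mem_Idl_insert[OF J_ideal dc] by blast
    have bc: "b \<in> carrier R" using c J.Icarr by blast
    show "\<forall>a\<in>max_ideal R. a \<otimes> x \<in> J"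
    proof
      fix a assume a: "a \<in> max_ideal R"
      have ac: "a \<in> carrier R" using a M.Icarr by blast
      have "a \<otimes> d \<in> I \<inter> Idl A"
        using socle_generator_mult_mem[OF I d a] YY.I_l_closed[OF dA ac] by blast
      then have "a \<otimes> d \<in> J" using subset_J by blast
      moreover have "a \<otimes> x = c \<otimes> (a \<otimes> d) \<oplus> a \<otimes> b" unfolding c(3) using ac c(1) dc bc by algebra
      ultimately show "a \<otimes> x \<in> J" using c ac J.I_l_closed by simp
    qed
  next
    assume Mx: "\<forall>a\<in>max_ideal R. a \<otimes> x \<in> J"
    \<comment> \<open>A unit in the socle would annihilate the maximal ideal modulo \<open>J\<close>.\<close>
    have "x \<in> max_ideal R"
    proof (rule ccontr)
      assume "x \<notin> max_ideal R"
      then obtain u where u: "u \<in> carrier R" "u \<otimes> x = \<one>" using unit_of_notin_max_ideal x by blast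
      have "max_ideal R \<subseteq> J"
      proof
        fix a assume a: "a \<in> max_ideal R"
        have ac: "a \<in> carrier R" using a M.Icarr by blast
        have "u \<otimes> (a \<otimes> x) = a \<otimes> (u \<otimes> x)" using u(1) ac x by algebra
        also have "\<dots> = a" using u(2) ac by simp
        finally show "a \<in> J" using J.I_l_closed[OF bspec[OF Mx a] u(1)] by simp
      qed
      then show False using max_ideal_not_subset_J by blast
    qed
    then obtain y z where yz: "y \<in> Idl A" "z \<in> Idl B" "x = y \<oplus> z" by (rule mem_max_ideal)
    have yc: "y \<in> carrier R" "z \<in> carrier R" using yz YY.Icarr ZZ.Icarr by auto
    have "a \<otimes> y \<in> I" if "a \<in> max_ideal R" for a
    proof -
      have ac: "a \<in> carrier R" using that M.Icarr by blast
      have "a \<otimes> y = a \<otimes> x \<ominus> a \<otimes> z" unfolding yz(3) using ac yc by algebra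
      moreover have "a \<otimes> x \<in> J" "a \<otimes> z \<in> J"
        using bspec[OF Mx that] ZZ.I_l_closed[OF yz(2) ac] subset_J(2) by auto
      ultimately have "a \<otimes> y \<in> J" using J.minus_closed by simp
      then show ?thesis using J_inter YY.I_l_closed[OF yz(1) ac] by blast
    qed
    then have "y \<in> Idl (insert d I)" using d yc(1) unfolding socle_generator_def by blast
    then obtain c i where c: "c \<in> carrier R" "i \<in> I" "y = c \<otimes> d \<oplus> i"
      unfolding mem_Idl_insert[OF I dc] by blast
    have ic: "i \<in> carrier R" using c I.Icarr by blast
    have "i = y \<ominus> c \<otimes> d" unfolding c(3) using c(1) dc ic by algebra
    moreover have "y \<ominus> c \<otimes> d \<in> Idl A" by (rule YY.minus_closed[OF yz(1) YY.I_l_closed[OF dA c(1)]])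
    ultimately have "i \<in> Idl A" by (rule ssubst)
    then have "i \<oplus> z \<in> J" using c(2) yz(2) unfolding memJ by (intro bexI[of _ i] bexI[of _ z]) simp_all
    moreover have "x = c \<otimes> d \<oplus> (i \<oplus> z)" unfolding yz(3) c(3) using c(1) dc ic yc by algebra
    ultimately show "x \<in> Idl (insert d J)" unfolding mem_Idl_insert[OF J_ideal dc] using c(1) by blast
  qed
qed

text \<open>For \<open>x = y + z\<close> in \<open>I\<close> with \<open>y \<in> \<langle>A\<rangle>\<close> and \<open>z \<in> \<langle>B\<rangle>\<close>, the element \<open>y\<close> is in the socle modulo \<open>I\<close>: it is
killed by \<open>\<langle>B\<rangle>\<close>, and \<open>u y = u x - u z \<in> I\<close> for \<open>u \<in> \<langle>A\<rangle>\<close>. So \<open>y = c d + i\<close> with \<open>i \<in> I\<close>, and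
\<open>x - c (d - e) = i + (z + c e)\<close>, where both summands lie in \<open>J\<close> and in its counterpart.\<close>

lemma I_eq_Idl_insert_inter:
  assumes d: "socle_generator I d" "d \<in> Idl A" and e: "e \<in> Idl B" "d \<ominus> e \<in> I"
  shows "I = Idl (insert (d \<ominus> e) (J \<inter> orthogonal_parameters.J R I B A))"
proof
  interpret S: orthogonal_parameters R I B A by (rule swapped)
  have dc: "d \<in> carrier R" "e \<in> carrier R" using d e YY.Icarr ZZ.Icarr by auto
  have JJ: "J \<inter> S.J \<subseteq> I"
  proof
    fix x assume x: "x \<in> J \<inter> S.J"
    then have "x \<in> J" by simp
    then obtain i z where iz: "i \<in> I \<inter> Idl A" "z \<in> Idl B" "x = i \<oplus> z" unfolding memJ by blast
    have ic: "i \<in> carrier R" "z \<in> carrier R" using iz I.Icarr ZZ.Icarr by auto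
    have "i \<in> S.J" using iz S.subset_J by blast
    moreover have "z = x \<ominus> i" unfolding iz(3) using ic by algebra
    moreover have "x \<ominus> i \<in> S.J"
      using x calculation(1) by (intro S.J.minus_closed) simp_all
    ultimately have "z \<in> S.J" by simp
    then have "z \<in> S.J \<inter> Idl B" using iz by simp
    then show "x \<in> I" unfolding S.J_inter iz(3) using iz(1) I.a_closed[of i z] by simp
  qed
  show "Idl (insert (d \<ominus> e) (J \<inter> S.J)) \<subseteq> I"
    using JJ e(2) by (intro genideal_minimal I) simp
  show "I \<subseteq> Idl (insert (d \<ominus> e) (J \<inter> S.J))"
  proof
    fix x assume xI: "x \<in> I"
    have x: "x \<in> carrier R" using xI I.Icarr by blast
    have "x \<in> max_ideal R" using xI primary unfolding maximal_primary_def by blast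
    then obtain y z where yz: "y \<in> Idl A" "z \<in> Idl B" "x = y \<oplus> z" by (rule mem_max_ideal)
    have yc: "y \<in> carrier R" "z \<in> carrier R" using yz YY.Icarr ZZ.Icarr by auto
    have "a \<otimes> y \<in> I" if a: "a \<in> max_ideal R" for a
    proof -
      obtain u v where uv: "u \<in> Idl A" "v \<in> Idl B" "a = u \<oplus> v" using a by (rule mem_max_ideal)
      have uc: "u \<in> carrier R" "v \<in> carrier R" using uv YY.Icarr ZZ.Icarr by auto
      have "a \<otimes> y = u \<otimes> x \<ominus> u \<otimes> z \<oplus> y \<otimes> v" unfolding uv(3) yz(3) using uc yc by algebra
      moreover have "u \<otimes> x \<in> I" "u \<otimes> z \<in> I" "y \<otimes> v \<in> I"
        using I.I_l_closed[OF xI uc(1)] mult_mem uv yz by auto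
      ultimately show ?thesis using I.minus_closed I.a_closed by simp
    qed
    then have "y \<in> Idl (insert d I)" using d(1) yc(1) unfolding socle_generator_def by blast
    then obtain c i where c: "c \<in> carrier R" "i \<in> I" "y = c \<otimes> d \<oplus> i"
      unfolding mem_Idl_insert[OF I dc(1)] by blast
    have ic: "i \<in> carrier R" using c I.Icarr by blast
    define j where "j = z \<oplus> c \<otimes> e"
    have iA: "i \<in> I \<inter> Idl A"
    proof -
      have "i = y \<ominus> c \<otimes> d" unfolding c(3) using c(1) dc ic by algebra
      moreover have "y \<ominus> c \<otimes> d \<in> Idl A" by (rule YY.minus_closed[OF yz(1) YY.I_l_closed[OF d(2) c(1)]])
      ultimately have "i \<in> Idl A" by (rule ssubst)
      then show ?thesis using c(2) by simp
    qed
    have jB: "j \<in> I \<inter> Idl B"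
    proof -
      have "j = x \<ominus> i \<ominus> c \<otimes> (d \<ominus> e)" unfolding j_def yz(3) c(3) using c(1) dc ic yc by algebra
      moreover have "x \<ominus> i \<ominus> c \<otimes> (d \<ominus> e) \<in> I"
        by (rule I.minus_closed[OF I.minus_closed[OF xI c(2)] I.I_l_closed[OF e(2) c(1)]])
      ultimately have "j \<in> I" by (rule ssubst)
      moreover have "j \<in> Idl B" unfolding j_def using ZZ.a_closed[OF yz(2) ZZ.I_l_closed[OF e(1) c(1)]] .
      ultimately show ?thesis by blast
    qed
    have "x = c \<otimes> (d \<ominus> e) \<oplus> (i \<oplus> j)" unfolding j_def yz(3) c(3) using c(1) dc ic yc by algebra
    moreover have "i \<in> J" "i \<in> S.J" "j \<in> J" "j \<in> S.J"
      using iA jB subset_J S.subset_J by blast+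
    ultimately have "\<exists>c \<in> carrier R. \<exists>b \<in> J \<inter> S.J. x = c \<otimes> (d \<ominus> e) \<oplus> b"
      using c(1) J.a_closed[of i j] S.J.a_closed[of i j]
      by (intro bexI[of _ c] bexI[of _ "i \<oplus> j"]) simp_all
    then show "x \<in> Idl (insert (d \<ominus> e) (J \<inter> S.J))"
      using mem_Idl_insert[OF i_intersect[OF J_ideal S.J_ideal], of "d \<ominus> e"] dc by simp
  qed
qed

lemma quotient_connected_summand:
  shows "connected_summand (R Quot max_ideal R) (R Quot J) (residue_proj R)"
proof -
  interpret p: local_ring_surjection R "R Quot J" "(+>) J"
    by (rule quotient_surjection[OF J_ideal J_subset])
  have ker: "p.ker = J" by (rule quotient_surjection(2)[OF J_ideal J_subset])
  obtain d where "d \<in> Idl A" "socle_generator I d" using ex_socle_generator by blast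
  then have "socle_generator J d" by (intro socle_generator_J)
  then have "gorenstein_artin_local (R Quot J)"
    unfolding p.gorenstein_artin_local_iff ker using maximal_primary_J by blast
  moreover have "max_ideal (R Quot J) \<noteq> {\<zero>\<^bsub>R Quot J\<^esub>}"
  proof
    assume *: "max_ideal (R Quot J) = {\<zero>\<^bsub>R Quot J\<^esub>}"
    have "max_ideal R \<subseteq> J"
    proof
      fix a assume a: "a \<in> max_ideal R"
      then have "J +> a \<in> max_ideal (R Quot J)" unfolding p.max_ideal_S by (rule imageI)
      then have "J +> a = \<zero>\<^bsub>R Quot J\<^esub>" unfolding * by simp
      then have "a \<in> p.ker" unfolding p.mem_ker using M.Icarr[OF a] by blast
      then show "a \<in> J" unfolding ker .
    qed
    then show False using max_ideal_not_subset_J by simp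
  qed
  moreover have "field (R Quot max_ideal R)"
    by (rule maximalideal.quotient_is_field[OF max_ideal_maximalideal is_cring])
  ultimately show ?thesis
    unfolding connected_summand_def using residue_proj_hom[OF J_ideal J_subset] by blast
qed

lemma max_ideal_subset_sum: "max_ideal R \<subseteq> J <+> orthogonal_parameters.J R I B A"
proof
  interpret S: orthogonal_parameters R I B A by (rule swapped)
  fix x assume "x \<in> max_ideal R"
  then obtain y z where yz: "y \<in> Idl A" "z \<in> Idl B" "x = y \<oplus> z" by (rule mem_max_ideal)
  then have "x = z \<oplus> y" using YY.Icarr ZZ.Icarr by (simp add: a_comm)
  moreover have "z \<in> J" "y \<in> S.J" using yz subset_J(2) S.subset_J(2) by auto
  ultimately show "x \<in> J <+> S.J" unfolding set_add_def' by blast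
qed

text \<open>Generators \<open>d \<in> \<langle>A\<rangle>\<close> and \<open>e \<in> \<langle>B\<rangle>\<close> of the socle modulo \<open>I\<close> are chosen congruent modulo \<open>I\<close>. Dividing the
fibre product by the image of \<open>d - e\<close> amounts to dividing \<open>R\<close> by \<open>\<langle>d - e\<rangle> + (J \<inter> J')\<close>, where \<open>J'\<close> is the
counterpart of \<open>J\<close>, and this ideal is \<open>I\<close>.\<close>

theorem is_connected_sum_of_quotients:
  assumes iso: "R Quot I \<simeq> Q"
  shows "is_connected_sum Q (R Quot max_ideal R) (R Quot J) (residue_proj R)
    (R Quot orthogonal_parameters.J R I B A) (residue_proj R)"
proof -
  interpret S: orthogonal_parameters R I B A by (rule swapped)
  interpret p: local_ring_surjection R "R Quot J" "(+>) J"
    by (rule quotient_surjection[OF J_ideal J_subset])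
  interpret q: local_ring_surjection R "R Quot S.J" "(+>) S.J"
    by (rule quotient_surjection[OF S.J_ideal S.J_subset])
  note kerp = quotient_surjection(2)[OF J_ideal J_subset]
  note kerq = quotient_surjection(2)[OF S.J_ideal S.J_subset]
  obtain d where d: "d \<in> Idl A" "socle_generator I d" using ex_socle_generator by blast
  obtain e0 where e0: "e0 \<in> Idl B" "socle_generator I e0" using S.ex_socle_generator by blast
  have dc: "d \<in> carrier R" and e0c: "e0 \<in> carrier R" and "e0 \<notin> I" "d \<notin> I"
    using d(2) e0(2) unfolding socle_generator_def by auto
  have Me0: "a \<otimes> e0 \<in> I" if "a \<in> max_ideal R" for a
    by (rule socle_generator_mult_mem[OF I e0(2) that])
  obtain c where c: "c \<in> carrier R" "c \<otimes> e0 \<ominus> d \<in> I"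
    using socle_generator_unit_multiple[OF I d(2) e0c \<open>e0 \<notin> I\<close> Me0] by blast
  \<comment> \<open>The unit \<open>c\<close> makes the two generators congruent modulo \<open>I\<close>.\<close>
  define e where "e = c \<otimes> e0"
  have ec: "e \<in> carrier R" and eB: "e \<in> Idl B"
    unfolding e_def using c(1) e0c ZZ.I_l_closed[OF e0(1)] by simp_all
  have de: "d \<ominus> e \<in> I"
  proof -
    have "d \<ominus> e = \<ominus> (e \<ominus> d)" using dc ec by algebra
    then show ?thesis using I.a_inv_closed[OF c(2)] unfolding e_def by simp
  qed
  have "e \<notin> I"
  proof
    assume "e \<in> I"
    then have "(d \<ominus> e) \<oplus> e \<in> I" using de by (intro I.a_closed)
    moreover have "(d \<ominus> e) \<oplus> e = d" using dc ec by algebra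
    ultimately show False using \<open>d \<notin> I\<close> by simp
  qed
  have Me: "a \<otimes> e \<in> I" if "a \<in> max_ideal R" for a
  proof -
    have "a \<otimes> e = c \<otimes> (a \<otimes> e0)"
      unfolding e_def using c(1) e0c M.Icarr[OF that] by (simp add: m_lcomm)
    then show ?thesis using I.I_l_closed[OF Me0[OF that] c(1)] by simp
  qed
  have e: "socle_generator I e" by (rule socle_generatorI[OF I d(2) ec \<open>e \<notin> I\<close> Me])

  define P where "P = fibre_product (R Quot J) (residue_proj R) (R Quot S.J) (residue_proj R)"
  define f where "f t = (J +> t, S.J +> t)" for t
  have fP: "local_ring_surjection R P f" "a_kernel R P f = J \<inter> S.J"
    using fibre_product_quotients[OF J_ideal J_subset S.J_ideal S.J_subset max_ideal_subset_sum]
    unfolding P_def f_def by auto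
  interpret f: local_ring_surjection R P f by (rule fP)
  interpret P: cring P by (rule f.S_cring)
  define W where "W = PIdl\<^bsub>P\<^esub> (f (d \<ominus> e))"
  have W: "ideal W P" unfolding W_def using dc ec by (intro P.cgenideal_ideal f.H.hom_closed) simp
  interpret W: ring_hom_ring P "P Quot W" "a_r_coset P W" by (rule ideal.rcos_ring_hom_ring[OF W])
  define g where "g = a_r_coset P W \<circ> f"
  have gh: "g \<in> ring_hom R (P Quot W)" unfolding g_def by (rule ring_hom_trans[OF f.hom W.homh])
  interpret g: ring_hom_ring R "P Quot W" g
    by (rule ring_hom_ringI2[OF ring_axioms W.S.ring_axioms gh])
  have "a_r_coset P W ` carrier P = carrier (P Quot W)" unfolding FactRing_simps by auto
  then have "g ` carrier R = carrier (P Quot W)"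
    unfolding g_def image_comp[symmetric] f.surj .
  then have "R Quot (a_kernel R (P Quot W) g) \<simeq> P Quot W" by (rule g.FactRing_iso)
  moreover have "a_kernel R (P Quot W) g = I"
  proof -
    have "g x = \<zero>\<^bsub>P Quot W\<^esub> \<longleftrightarrow> x \<in> I" if x: "x \<in> carrier R" for x
    proof -
      have "g x = \<zero>\<^bsub>P Quot W\<^esub> \<longleftrightarrow> a_r_coset P W (f x) = W" unfolding g_def FactRing_def by simp
      also have "\<dots> \<longleftrightarrow> f x \<in> W"
        using ideal.rcos_const_imp_mem[OF W f.H.hom_closed[OF x]] f.S.a_rcos_zero[OF W] by blast
      also have "\<dots> \<longleftrightarrow> x \<in> Idl (insert (d \<ominus> e) (J \<inter> S.J))"
        unfolding W_def fP(2)[symmetric] using dc ec by (intro f.h_mem_PIdl_iff x) simp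
      also have "\<dots> \<longleftrightarrow> x \<in> I" using I_eq_Idl_insert_inter[OF d(2,1) eB de] by simp
      finally show ?thesis .
    qed
    then have "a_kernel R (P Quot W) g = {x \<in> carrier R. x \<in> I}"
      unfolding a_kernel_def' by (intro Collect_cong conj_cong refl)
    then show ?thesis using I.a_subset by blast
  qed
  ultimately have "R Quot I \<simeq> P Quot W" by simp
  moreover have "Q \<simeq> R Quot I" by (rule ring_iso_sym[OF I.quotient_is_ring iso])
  ultimately have Q: "Q \<simeq> P Quot W" by (metis ring_iso_trans)
  have "f d = (J +> d, \<zero>\<^bsub>R Quot S.J\<^esub>)" "f e = (\<zero>\<^bsub>R Quot J\<^esub>, S.J +> e)"
    unfolding f_def FactRing_def
    using a_rcos_zero[OF J_ideal] a_rcos_zero[OF S.J_ideal] d(1) eB subset_J(2) S.subset_J(2) by auto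
  moreover have "f (d \<ominus> e) = f d \<ominus>\<^bsub>P\<^esub> f e" using dc ec by (simp add: a_minus_def)
  ultimately have "Q \<simeq> connected_sum (R Quot J) (residue_proj R) (J +> d)
      (R Quot S.J) (residue_proj R) (S.J +> e)"
    using Q unfolding connected_sum_def P_def[symmetric] W_def Let_def by simp
  moreover have "soc (R Quot J) = PIdl\<^bsub>R Quot J\<^esub> (J +> d)"
    using p.soc_eq_PIdl_iff[OF dc] socle_generator_J[OF d(2,1)] unfolding kerp by blast
  moreover have "soc (R Quot S.J) = PIdl\<^bsub>R Quot S.J\<^esub> (S.J +> e)"
    using q.soc_eq_PIdl_iff[OF ec] S.socle_generator_J[OF e eB] unfolding kerq by blast
  ultimately show ?thesis
    unfolding is_connected_sum_def
    using quotient_connected_summand S.quotient_connected_summand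
      p.H.hom_closed[OF dc] q.H.hom_closed[OF ec] by blast
qed

end

theorem proposition4p1:
  fixes Q :: "('q, 'x) ring_scheme"
    and Qt :: "('a, 'y) ring_scheme"
    and I_Q J_R J_S YY ZZ :: "'a set"
    and Y Z :: "nat \<Rightarrow> 'a"
    and m n :: nat
    and R S k :: "'a set ring"
  assumes "gorenstein_artin_local Q"
    and "cohen_presentation Q Qt I_Q"
    and "m \<ge> 1" and "n \<ge> 1"
    and "Y \<in> {1..m} \<rightarrow> carrier Qt" and "Z \<in> {1..n} \<rightarrow> carrier Qt"
    and "max_ideal Qt = Idl\<^bsub>Qt\<^esub> (Y ` {1..m} \<union> Z ` {1..n})"
    and minimal_generators: "m + n = edim Qt"
    and "YY = Idl\<^bsub>Qt\<^esub> (Y ` {1..m})"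
    and "ZZ = Idl\<^bsub>Qt\<^esub> (Z ` {1..n})"
    and "J_R = (I_Q \<inter> YY) <+>\<^bsub>Qt\<^esub> ZZ"
    and "J_S = (I_Q \<inter> ZZ) <+>\<^bsub>Qt\<^esub> YY"
    and "R = Qt Quot J_R"
    and "S = Qt Quot J_S"
    and "k = Qt Quot (max_ideal Qt)"
    and "\<forall>i \<in> {1..m}. \<forall>j \<in> {1..n}. Y i \<otimes>\<^bsub>Qt\<^esub> Z j \<in> I_Q"
  shows "(I_Q \<inter> YY = J_R \<inter> YY \<and> I_Q \<inter> ZZ = J_S \<inter> ZZ) \<and>
         (gorenstein_artin_local R \<and> gorenstein_artin_local S) \<and>
         is_connected_sum Q k R (residue_proj Qt) S (residue_proj Qt)"
proof -
  define A where "A = Y ` {1..m}"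
  define B where "B = Z ` {1..n}"
  have pres: "local_ring Qt" "regular_local_ring Qt" "ideal I_Q Qt"
    "I_Q \<subseteq> ideal_pow Qt (max_ideal Qt) 2" "Qt Quot I_Q \<simeq> Q"
    using assms(2) unfolding cohen_presentation_def regular_local_ring_def by auto
  interpret local_ring Qt by (rule pres)
  interpret Q: local_ring Q using assms(1) unfolding gorenstein_artin_local_def by blast
  have "I_Q \<subseteq> max_ideal Qt"
    using pres(4) ideal_pow_Suc_subset[OF M.is_ideal, of 1] by (simp add: numeral_2_eq_2)
  then obtain h where h: "local_ring_surjection Qt Q h" "a_kernel Qt Q h = I_Q"
    using iso_quotient_surjection[OF pres(3) _ pres(5) Q.ring_axioms] by blast
  have gor: "maximal_primary I_Q" "\<exists>d. socle_generator I_Q d"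
    using local_ring_surjection.gorenstein_artin_local_iff[OF h(1)] assms(1) h(2) by auto

  have fin: "finite A" "finite B" and carr: "A \<subseteq> carrier Qt" "B \<subseteq> carrier Qt"
    unfolding A_def B_def using assms(5,6) by auto
  have cards: "card A \<le> m" "card B \<le> n"
    unfolding A_def B_def using card_image_le[of "{1..m}" Y] card_image_le[of "{1..n}" Z] by auto
  have MAB: "max_ideal Qt = Idl\<^bsub>Qt\<^esub> (A \<union> B)" using assms(7) unfolding A_def B_def .
  \<comment> \<open>The generators are minimal in number, so the two blocks are disjoint.\<close>
  have "edim Qt \<le> card (A \<union> B)"
    unfolding edim_def
  proof (rule Least_le)
    show "\<exists>G\<subseteq>carrier Qt. finite G \<and> card G = card (A \<union> B) \<and> max_ideal Qt = Idl\<^bsub>Qt\<^esub> G"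
      using fin carr MAB by (intro exI[of _ "A \<union> B"]) auto
  qed
  then have card: "card (A \<union> B) = edim Qt" "card (A \<inter> B) = 0"
    using card_Un_Int[OF fin] cards minimal_generators by linarith+
  have reg: "regular_modulo (Idl\<^bsub>Qt\<^esub> {}) (A \<union> B)"
    by (rule regular_local_ring_regular_modulo[OF pres(2)]) (use fin carr MAB card in auto)
  have ortho: "a \<otimes>\<^bsub>Qt\<^esub> b \<in> I_Q" if "a \<in> A" "b \<in> B" for a b
    using that assms(16) unfolding A_def B_def by auto
  interpret O: orthogonal_parameters Qt I_Q A B
    using card(2) fin assms(3,4)
    by (intro orthogonal_parameters.intro orthogonal_parameters_axioms.intro local_ring_axioms
        pres reg gor ortho) (auto simp: A_def B_def)
  interpret O': orthogonal_parameters Qt I_Q B A by (rule O.swapped)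
  have eqs: "YY = Idl\<^bsub>Qt\<^esub> A" "ZZ = Idl\<^bsub>Qt\<^esub> B" "J_R = O.J" "J_S = O'.J"
    using assms(9-12) unfolding A_def[symmetric] B_def[symmetric] O.J_def O'.J_def by simp_all
  have "is_connected_sum Q k R (residue_proj Qt) S (residue_proj Qt)"
    unfolding assms(13-15) eqs by (rule O.is_connected_sum_of_quotients[OF pres(5)])
  then show ?thesis
    using O.J_inter O'.J_inter unfolding eqs is_connected_sum_def connected_summand_def by simp
qed

end
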